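(* Let $(\mathbf X_n^I)_{n\ge1}$ be partially $\mathcal G$-c.i.d. with directing random measures $(\alpha_i)_{i\in I}$. Then $(\mathbf X_n^I)$ is asymptotically partially exchangeable with limit directing measures $(\alpha_i)_{i\in I}$: as $n\to\infty$, $(\mathbf X^I_{n+1},\mathbf X^I_{n+2},\dots)$ converges in distribution to $(\mathbf Z^I_1,\mathbf Z^I_2,\dots)$, where $[Z_{m,i}]_{m\ge1,i\in I}$ is a partially exchangeable array such that, conditionally on $(\alpha_i)_{i\in I}$, the $Z_{m,i}$ are independent with $Z_{m,i}$ having law $\alpha_i$.
   Context: All random elements live on $(\Omega,\mathcal F,\mathbb P)$; $\mathbb X$ is Polish with Borel $\sigma$-algebra $\mathcal X$; $I$ is a finite or countable index set; $[X_{n,i}]_{n\ge1,i\in I}$ is an array of $\mathbb X$-valued random variables with rows $\mathbf X_n^I=(X_{n,i})_{i\in I}$; convergence in distribution of sequences of rows refers to the product topology on $(\mathbb X^I)^{\mathbb N}$. For a filtration $\mathcal G=(\mathcal G_n)_{n\ge0}$ and $j\in I$, $\mathcal G_n^j=\mathcal G_n\vee\sigma(X_{n+1,i}:i\ne j)$. The process is partially $\mathcal G$-c.i.d. if it is adapted to $\mathcal G$ and $\mathbb E[f(X_{n+1,j})\mid\mathcal G_n^j]=\mathbb E[f(X_{n+k,j})\mid\mathcal G_n^j]$ a.s. for all $j\in I$, $k\ge1$, $n\ge0$ and bounded measurable $f$. In that case $\mathbb P[X_{n+1,i}\in\cdot\mid\mathcal G_n]$ converges weakly $\mathbb P$-a.s.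 to a random probability measure $\alpha_i$; $(\alpha_i)_{i\in I}$ are the directing random measures. An array is partially exchangeable if its law is invariant under separate finite permutations of each column. *)

theory Defs
  imports "HOL-Probability.Probability"
begin

definition weak_conv_top :: "(nat \<Rightarrow> 'a::topological_space measure) \<Rightarrow> 'a measure \<Rightarrow> bool" where
  "weak_conv_top \<mu>s \<mu> \<longleftrightarrow>
     (\<forall>f :: 'a \<Rightarrow> real. continuous_on UNIV f \<and> bounded (range f) \<longrightarrow>
        (\<lambda>n. \<integral>x. f x \<partial>(\<mu>s n)) \<longlonglongrightarrow> (\<integral>x. f x \<partial>\<mu>))"

definition filtration_on :: "'w measure \<Rightarrow> (nat \<Rightarrow> 'w measure) \<Rightarrow> bool" where
  "filtration_on M G \<longleftrightarrow>
     (\<forall>n. space (G n) = space M \<and> sets (G n) \<subseteq> sets M \<and> sets (G n) \<subseteq> sets (G (Suc n)))"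

text \<open>The sigma-algebra G_n^j = G_n joined with sigma(X_{n+1,i} : i \<noteq> j).
  Rows are indexed by n \<ge> 1; X 0 is unused.\<close>
definition Gj :: "'w measure \<Rightarrow> (nat \<Rightarrow> 'w measure) \<Rightarrow> (nat \<Rightarrow> 'i \<Rightarrow> 'w \<Rightarrow> 'x::topological_space)
                   \<Rightarrow> nat \<Rightarrow> 'i \<Rightarrow> 'w measure" where
  "Gj M G X n j = sigma (space M)
     (sets (G n) \<union> (\<Union>i\<in>{i. i \<noteq> j}. {X (Suc n) i -` A \<inter> space M | A. A \<in> sets borel}))"

definition partially_cid :: "'w measure \<Rightarrow> (nat \<Rightarrow> 'w measure) \<Rightarrow> (nat \<Rightarrow> 'i \<Rightarrow> 'w \<Rightarrow> 'x::topological_space) \<Rightarrow> bool" where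
  "partially_cid M G X \<longleftrightarrow>
     (\<forall>n\<ge>1. \<forall>i. X n i \<in> measurable (G n) borel) \<and>
     (\<forall>j k n (f :: 'x \<Rightarrow> real). k \<ge> 1 \<and> f \<in> borel_measurable borel \<and> bounded (range f) \<longrightarrow>
        (AE \<omega> in M. real_cond_exp M (Gj M G X n j) (\<lambda>\<omega>. f (X (n + 1) j \<omega>)) \<omega>
                    = real_cond_exp M (Gj M G X n j) (\<lambda>\<omega>. f (X (n + k) j \<omega>)) \<omega>))"

definition reg_cond_distr :: "'w measure \<Rightarrow> 'w measure \<Rightarrow> ('w \<Rightarrow> 'x::topological_space) \<Rightarrow> ('w \<Rightarrow> 'x measure) \<Rightarrow> bool" where
  "reg_cond_distr M F Y K \<longleftrightarrow>
     K \<in> measurable F (prob_algebra borel) \<and>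
     (\<forall>A \<in> sets borel. AE \<omega> in M. measure (K \<omega>) A = real_cond_exp M F (\<lambda>\<omega>. indicator A (Y \<omega>)) \<omega>)"

definition directing_measures :: "'w measure \<Rightarrow> (nat \<Rightarrow> 'w measure) \<Rightarrow> (nat \<Rightarrow> 'i \<Rightarrow> 'w \<Rightarrow> 'x::topological_space)
     \<Rightarrow> ('i \<Rightarrow> 'w \<Rightarrow> 'x measure) \<Rightarrow> bool" where
  "directing_measures M G X \<alpha> \<longleftrightarrow>
     (\<forall>i. \<alpha> i \<in> measurable M (prob_algebra borel)) \<and>
     (\<forall>i K. (\<forall>n. reg_cond_distr M (G n) (X (Suc n) i) (K n)) \<longrightarrow>
        (AE \<omega> in M. weak_conv_top (\<lambda>n. K n \<omega>) (\<alpha> i \<omega>)))"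

definition mixture_law :: "'w measure \<Rightarrow> ('i \<Rightarrow> 'w \<Rightarrow> 'x measure) \<Rightarrow> (nat \<Rightarrow> 'i \<Rightarrow> 'x) measure" where
  "mixture_law M \<alpha> = M \<bind> (\<lambda>\<omega>. PiM UNIV (\<lambda>m::nat. PiM UNIV (\<lambda>i. \<alpha> i \<omega>)))"

definition partially_exchangeable_law :: "(nat \<Rightarrow> 'i \<Rightarrow> 'x) measure \<Rightarrow> bool" where
  "partially_exchangeable_law L \<longleftrightarrow>
     (\<forall>\<pi> :: 'i \<Rightarrow> nat \<Rightarrow> nat. (\<forall>i. \<exists>F. finite F \<and> \<pi> i permutes F) \<longrightarrow>
        distr L L (\<lambda>z m i. z (\<pi> i m) i) = L)"

end

(*
  For a bounded continuous f, the c.i.d. property and the convergence of the predictive measures give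
  E[H f(X_{n+1,j})] = E[H alpha_j(f)] for every bounded G_n^j-measurable H.  Applied to the cells of
  a finite product from the last row downwards, with alpha_j(f) replaced each time by the
  G_n-measurable predictive integral, which is L^1-close to it, this yields
  E[prod f_c(X_{n+m,i})] -> E[prod alpha_i(f_c)].  Products of continuous functions of finitely many
  cells determine both weak convergence and equality of laws on the countable product of Polish
  spaces.  The hypothesis on alpha quantifies over regular conditional distributions, so that these
  have to be shown to exist.
*)
theory Submission
  imports Defs
begin

section \<open>Weak convergence from a multiplicative class of test functions\<close>

text \<open>The limits are independent across columns because G_n^j contains the other cells of row
  n+1: while cell j is integrated out, its neighbours in the same row can stay in the weight H. The
  obstacle is that integrating a cell out leaves \<alpha>_j(f), which is only known to be measurable
  for \<open>M\<close>, so the c.i.d. identity cannot be applied to a weight that contains it.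
  Predictive integrals are admissible weights, and since every factor lies in [0,1], the error of
  the exchange vanishes by dominated convergence even though the remaining factors need not
  converge.

  On the topological side the limit is known beforehand to be a probability measure, so no tightness
  argument enters. A class closed under products that locally separates points from closed sets
  already yields the lower bound of the portmanteau theorem on open sets. Equality of two laws is
  the same bound for constant sequences, used in both directions.\<close>

lemma card_nat_below_bounds:
  fixes t :: real
  assumes "0 \<le> t" "t \<le> real N"
  shows "real (card {k\<in>{1..N}. real k < t}) \<le> t" "t \<le> real (card {k\<in>{1..N}. real k < t}) + 1"
proof -
  have "{k\<in>{1..N}. real k < t} = {1..<nat \<lceil>t\<rceil>}"
    using assms by (auto; linarith)
  then have c: "card {k\<in>{1..N}. real k < t} = nat \<lceil>t\<rceil> - 1"
    by simp
  show "real (card {k\<in>{1..N}. real k < t}) \<le> t" "t \<le> real (card {k\<in>{1..N}. real k < t}) + 1"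
    unfolding c using assms by linarith+
qed

text \<open>Closure under products is the only algebraic requirement, as sums or complements of
  cylinder functions are no cylinder functions. The separation axiom asks for a function squeezed
  between the indicators of a neighbourhood \<open>W\<close> and of \<open>U\<close>.\<close>

locale convergence_determining =
  fixes \<P> :: "('a::second_countable_topology \<Rightarrow> real) set"
  assumes measurable_P: "g \<in> \<P> \<Longrightarrow> g \<in> borel_measurable borel"
    and nonneg_P: "g \<in> \<P> \<Longrightarrow> 0 \<le> g x"
    and le_one_P: "g \<in> \<P> \<Longrightarrow> g x \<le> 1"
    and one_P: "(\<lambda>_. 1) \<in> \<P>"
    and mult_P: "g \<in> \<P> \<Longrightarrow> h \<in> \<P> \<Longrightarrow> (\<lambda>x. g x * h x) \<in> \<P>"
    and separating_P: "open U \<Longrightarrow> x \<in> U \<Longrightarrow>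
      \<exists>g\<in>\<P>. \<exists>W. open W \<and> x \<in> W \<and> (\<forall>y\<in>W. g y = 1) \<and> (\<forall>y. y \<notin> U \<longrightarrow> g y = 0)"
begin

text \<open>Since \<open>1 - g l\<close> may lie outside the class, the product of complements is
  expanded one factor at a time. The prefactor \<open>p\<close> collects the factors
  \<open>g k\<close> picked up on the way, so it must vary in the induction.\<close>

lemma tendsto_integral_mult_prod_compl:
  fixes g :: "nat \<Rightarrow> 'a \<Rightarrow> real"
  assumes prob: "\<And>n. prob_space (\<mu>s n)" "prob_space \<mu>"
    and sets: "\<And>n. sets (\<mu>s n) = sets borel" "sets \<mu> = sets borel"
    and conv: "\<And>g. g \<in> \<P> \<Longrightarrow> (\<lambda>n. \<integral>x. g x \<partial>\<mu>s n) \<longlonglongrightarrow> (\<integral>x. g x \<partial>\<mu>)"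
    and g: "\<And>l. g l \<in> \<P>" and p: "p \<in> \<P>"
  shows "(\<lambda>n. \<integral>x. p x * (\<Prod>l<k. 1 - g l x) \<partial>\<mu>s n) \<longlonglongrightarrow> (\<integral>x. p x * (\<Prod>l<k. 1 - g l x) \<partial>\<mu>)"
  using p
proof (induction k arbitrary: p)
  case 0
  then show ?case using conv by simp
next
  case (Suc k)
  have int: "integrable \<nu> (\<lambda>x. q x * (\<Prod>l<k. 1 - g l x))"
    if "q \<in> \<P>" "prob_space \<nu>" "sets \<nu> = sets borel" for \<nu> q
  proof -
    interpret prob_space \<nu> by fact
    have "\<bar>q x * (\<Prod>l<k. 1 - g l x)\<bar> \<le> 1" for x
    proof -
      have "\<bar>\<Prod>l<k. 1 - g l x\<bar> \<le> 1"
        unfolding abs_prod using nonneg_P[OF g] le_one_P[OF g] by (intro prod_le_1) (auto simp: abs_le_iff)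
      moreover have "\<bar>q x\<bar> \<le> 1" using nonneg_P le_one_P that by (auto simp: abs_le_iff)
      ultimately show ?thesis unfolding abs_mult by (intro mult_le_one) auto
    qed
    moreover have "(\<lambda>x. q x * (\<Prod>l<k. 1 - g l x)) \<in> borel_measurable \<nu>"
      unfolding measurable_cong_sets[OF that(3) refl]
      using measurable_P[OF g] measurable_P[OF that(1)] by measurable
    ultimately show ?thesis by (intro integrable_const_bound[where B=1]) auto
  qed
  have eq: "(\<integral>x. p x * (\<Prod>l<Suc k. 1 - g l x) \<partial>\<nu>) =
      (\<integral>x. p x * (\<Prod>l<k. 1 - g l x) \<partial>\<nu>) - (\<integral>x. (p x * g k x) * (\<Prod>l<k. 1 - g l x) \<partial>\<nu>)"
    if "prob_space \<nu>" "sets \<nu> = sets borel" for \<nu>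
    using int[OF Suc.prems that] int[OF mult_P[OF Suc.prems g[of k]] that]
    by (subst Bochner_Integration.integral_diff[symmetric]) (auto simp: algebra_simps)
  show ?case
    unfolding eq[OF prob(1) sets(1)] eq[OF prob(2) sets(2)]
    by (intro tendsto_diff Suc.IH mult_P Suc.prems g)
qed

text \<open>By Lindelof, countably many plateaus \<open>W l\<close> cover \<open>U\<close>, and
  finite products of the complements \<open>1 - g l\<close> approximate the indicator of the
  complement of \<open>U\<close> from above. One such product, fixed before n grows, bounds the mass
  outside \<open>U\<close> for all late n.\<close>

lemma eventually_measure_open_gt:
  assumes prob: "\<And>n. prob_space (\<mu>s n)" "prob_space \<mu>"
    and sets: "\<And>n. sets (\<mu>s n) = sets borel" "sets \<mu> = sets borel"
    and conv: "\<And>g. g \<in> \<P> \<Longrightarrow> (\<lambda>n. \<integral>x. g x \<partial>\<mu>s n) \<longlonglongrightarrow> (\<integral>x. g x \<partial>\<mu>)"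
    and U: "open U" and e: "e > 0"
  shows "\<forall>\<^sub>F n in sequentially. measure (\<mu>s n) U > measure \<mu> U - e"
proof (cases "U = {}")
  case True
  then show ?thesis using e by simp
next
  case False
  define \<F> where "\<F> = {W. open W \<and> (\<exists>g\<in>\<P>. (\<forall>y\<in>W. g y = 1) \<and> (\<forall>y. y \<notin> U \<longrightarrow> g y = 0))}"
  have UF: "\<Union>\<F> = U"
  proof
    show "\<Union>\<F> \<subseteq> U" unfolding \<F>_def by force
    show "U \<subseteq> \<Union>\<F>" unfolding \<F>_def using separating_P[OF U] by blast
  qed
  obtain \<F>' where F': "\<F>' \<subseteq> \<F>" "countable \<F>'" "\<Union>\<F>' = \<Union>\<F>"
    using Lindelof[of \<F>] unfolding \<F>_def by blast
  define W where "W = from_nat_into \<F>'"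
  have "\<F>' \<noteq> {}" using False F' UF by auto
  then have W: "range W = \<F>'" unfolding W_def using F'(2) by simp
  have "\<exists>g\<in>\<P>. (\<forall>y\<in>W l. g y = 1) \<and> (\<forall>y. y \<notin> U \<longrightarrow> g y = 0)" for l
    using W F'(1) unfolding \<F>_def by blast
  then obtain g where g: "\<And>l. g l \<in> \<P>" "\<And>l y. y \<in> W l \<Longrightarrow> g l y = 1" "\<And>l y. y \<notin> U \<Longrightarrow> g l y = 0"
    by metis
  note [measurable] = measurable_P[OF g(1)]
  \<comment> \<open>\<open>R k\<close> equals 1 off \<open>U\<close>, dominates the indicator of the
    complement, and vanishes on \<open>W l\<close> as soon as k > l.\<close>
  define R where "R k x = (\<Prod>l<k. 1 - g l x)" for k x
  have Rm[measurable]: "R k \<in> borel_measurable borel" for k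
    unfolding R_def by measurable
  have R01: "0 \<le> R k x" "R k x \<le> 1" for k x
    unfolding R_def using nonneg_P[OF g(1)] le_one_P[OF g(1)] by (auto intro!: prod_nonneg prod_le_1)
  have R_out: "R k x = 1" if "x \<notin> U" for k x
    unfolding R_def using g(3)[OF that] by simp
  have R_in: "R k x = 0" if "x \<in> W l" "l < k" for k l x
    unfolding R_def using g(2)[OF that(1)] that(2) by (auto intro!: prod_zero bexI[of _ l])
  have R_int: "integrable \<nu> (R k)" if "prob_space \<nu>" "sets \<nu> = sets borel" for \<nu> k
  proof -
    interpret prob_space \<nu> by fact
    show ?thesis
      using R01 Rm[of k] unfolding measurable_cong_sets[OF that(2) refl, symmetric]
      by (intro integrable_const_bound[where B=1]) auto
  qed
  have U_meas: "U \<in> sets \<nu>" if "sets \<nu> = sets borel" for \<nu>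
    using U that by simp
  have ind: "(\<integral>x. 1 - indicator U x \<partial>\<nu>) = 1 - measure \<nu> U" if "prob_space \<nu>" "sets \<nu> = sets borel" for \<nu> :: "'a measure"
  proof -
    interpret prob_space \<nu> by fact
    show ?thesis using U_meas[OF that(2)] sets_eq_imp_space_eq[OF that(2)]
        prob_space
      by (subst Bochner_Integration.integral_diff) (auto simp: emeasure_eq_measure)
  qed
  interpret mu: prob_space \<mu> by fact
  have "(\<lambda>k. \<integral>x. R k x \<partial>\<mu>) \<longlonglongrightarrow> (\<integral>x. 1 - indicator U x \<partial>\<mu>)"
  proof (rule integral_dominated_convergence[where w="\<lambda>_. 1"])
    show "(\<lambda>x. 1 - indicator U x :: real) \<in> borel_measurable \<mu>" using U_meas[OF sets(2)] by (intro borel_measurable_diff borel_measurable_const borel_measurable_indicator)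
    show "R k \<in> borel_measurable \<mu>" for k using Rm[of k] by (simp add: measurable_cong_sets[OF sets(2) refl])
    show "AE x in \<mu>. (\<lambda>k. R k x) \<longlonglongrightarrow> 1 - indicator U x"
    proof (rule AE_I2)
      fix x
      show "(\<lambda>k. R k x) \<longlonglongrightarrow> 1 - indicator U x"
      proof (cases "x \<in> U")
        case True
        then obtain l where "x \<in> W l" using F'(3) UF W by blast
        then have "\<forall>\<^sub>F k in sequentially. R k x = 0"
          using R_in by (auto intro!: eventually_sequentiallyI[of "Suc l"])
        then show ?thesis using True by (simp add: tendsto_eventually)
      qed (simp add: R_out)
    qed
  qed (use R01 in auto)
  then have "(\<lambda>k. \<integral>x. R k x \<partial>\<mu>) \<longlonglongrightarrow> 1 - measure \<mu> U"
    using ind[OF prob(2) sets(2)] by simp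
  then have "\<forall>\<^sub>F k in sequentially. (\<integral>x. R k x \<partial>\<mu>) < 1 - measure \<mu> U + e/2"
    by (rule order_tendstoD) (use e in simp)
  then obtain k where k: "(\<integral>x. R k x \<partial>\<mu>) < 1 - measure \<mu> U + e/2"
    by (auto simp: eventually_sequentially)
  have "(\<lambda>n. \<integral>x. R k x \<partial>\<mu>s n) \<longlonglongrightarrow> (\<integral>x. R k x \<partial>\<mu>)"
    using tendsto_integral_mult_prod_compl[OF prob sets conv g(1) one_P, where k=k] by (simp add: R_def)
  then have "\<forall>\<^sub>F n in sequentially. (\<integral>x. R k x \<partial>\<mu>s n) < (\<integral>x. R k x \<partial>\<mu>) + e/2"
    by (rule order_tendstoD) (use e in simp)
  then show ?thesis
  proof eventually_elim
    case (elim n)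
    have "1 - measure (\<mu>s n) U \<le> (\<integral>x. R k x \<partial>\<mu>s n)"
      unfolding ind[OF prob(1)[of n] sets(1)[of n], symmetric]
    proof (rule integral_mono)
      interpret prob_space "\<mu>s n" by (rule prob)
      show "integrable (\<mu>s n) (\<lambda>x. 1 - indicator U x :: real)"
        using U_meas[OF sets(1)[of n]] by (auto simp: emeasure_eq_measure)
    qed (use R_int prob sets R01 R_out in \<open>auto simp: indicator_def\<close>)
    then show ?case using k elim by simp
  qed
qed

text \<open>A discrete layer-cake formula: averaging the indicators of the N superlevel sets of
  \<open>F\<close> gives \<open>F\<close> up to 1/N, and these sets are open because
  \<open>F\<close> is continuous and the inequality is strict.\<close>

lemma eventually_integral_gt:
  assumes prob: "\<And>n. prob_space (\<mu>s n)" "prob_space \<mu>"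
    and sets: "\<And>n. sets (\<mu>s n) = sets borel" "sets \<mu> = sets borel"
    and conv: "\<And>g. g \<in> \<P> \<Longrightarrow> (\<lambda>n. \<integral>x. g x \<partial>\<mu>s n) \<longlonglongrightarrow> (\<integral>x. g x \<partial>\<mu>)"
    and F: "continuous_on UNIV F" "\<And>x. 0 \<le> F x" "\<And>x. F x \<le> (1::real)" and e: "e > 0"
  shows "\<forall>\<^sub>F n in sequentially. (\<integral>x. F x \<partial>\<mu>s n) > (\<integral>x. F x \<partial>\<mu>) - e"
proof -
  \<comment> \<open>Half of e pays for the discretisation, the other half for the loss on the N open
    sets.\<close>
  obtain N :: nat where N: "N > 0" "1 / real N < e / 2"
    using e by (metis half_gt_zero nat_approx_posE zero_less_Suc)
  define U where "U k = {x. real k / N < F x}" for k :: nat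
  have U: "open (U k)" for k
    unfolding U_def by (intro open_Collect_less F continuous_on_const)
  have Fm: "F \<in> borel_measurable borel" using F(1) by (rule borel_measurable_continuous_onI)
  define S where "S \<nu> = (\<Sum>k=1..N. measure \<nu> (U k)) / N" for \<nu>
  have S: "S \<nu> \<le> (\<integral>x. F x \<partial>\<nu>)" "(\<integral>x. F x \<partial>\<nu>) \<le> S \<nu> + 1 / N"
    if "prob_space \<nu>" "sets \<nu> = sets borel" for \<nu>
  proof -
    interpret prob_space \<nu> by fact
    have [measurable]: "U k \<in> sets \<nu>" for k using U that by simp
    have i: "integrable \<nu> (\<lambda>x. (\<Sum>k=1..N. indicator (U k) x :: real) / N)"
      by (auto simp: emeasure_eq_measure)
    have iF: "integrable \<nu> F"
      using F Fm by (intro integrable_const_bound[where B=1]) (auto simp: measurable_cong_sets[OF that(2) refl])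
    have Seq: "S \<nu> = (\<integral>x. (\<Sum>k=1..N. indicator (U k) x) / N \<partial>\<nu>)"
      using sets_eq_imp_space_eq[OF that(2)]
      by (simp add: S_def Bochner_Integration.integral_sum emeasure_eq_measure)
    have c: "(\<Sum>k=1..N. indicator (U k) x) = real (card {k\<in>{1..N}. real k < N * F x})" for x
    proof -
      have "(\<Sum>k=1..N. indicator (U k) x) = (\<Sum>k\<in>{1..N}. if real k < N * F x then 1 else (0::real))"
        using N by (intro sum.cong) (auto simp: U_def indicator_def field_simps)
      also have "\<dots> = real (card {k\<in>{1..N}. real k < N * F x})"
        by (simp add: sum.If_cases Int_def)
      finally show ?thesis .
    qed
    have b: "(\<Sum>k=1..N. indicator (U k) x) / N \<le> F x" "F x \<le> (\<Sum>k=1..N. indicator (U k) x) / N + 1 / N" for x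
      unfolding c using card_nat_below_bounds[of "N * F x" N] N F(2,3)[of x]
      by (auto simp: field_simps mult_left_le)
    show "S \<nu> \<le> (\<integral>x. F x \<partial>\<nu>)"
      unfolding Seq by (intro integral_mono i iF b)
    have "(\<integral>x. F x \<partial>\<nu>) \<le> (\<integral>x. (\<Sum>k=1..N. indicator (U k) x) / N + 1 / N \<partial>\<nu>)"
      by (intro integral_mono iF b Bochner_Integration.integrable_add i) auto
    also have "\<dots> = S \<nu> + 1 / N"
      unfolding Seq using i by (subst Bochner_Integration.integral_add) (auto simp: prob_space)
    finally show "(\<integral>x. F x \<partial>\<nu>) \<le> S \<nu> + 1 / N" .
  qed
  have "\<forall>\<^sub>F n in sequentially. \<forall>k\<in>{1..N}. measure (\<mu>s n) (U k) > measure \<mu> (U k) - e / 2"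
    using eventually_measure_open_gt[OF prob sets conv U, of "e/2"] e
    by (intro eventually_ball_finite) auto
  then show ?thesis
  proof eventually_elim
    case (elim n)
    have "(\<Sum>k=1..N. measure \<mu> (U k)) \<le> (\<Sum>k=1..N. measure (\<mu>s n) (U k) + e / 2)"
      using elim by (intro sum_mono) force
    also have "\<dots> = (\<Sum>k=1..N. measure (\<mu>s n) (U k)) + N * (e / 2)"
      by (simp add: sum.distrib)
    finally have "S \<mu> \<le> ((\<Sum>k=1..N. measure (\<mu>s n) (U k)) + N * (e / 2)) / N"
      unfolding S_def by (rule divide_right_mono) simp
    also have "\<dots> = S (\<mu>s n) + e / 2"
      using N by (simp add: S_def add_divide_distrib)
    finally have "S \<mu> \<le> S (\<mu>s n) + e / 2" .
    then show ?case
      using S(2)[OF prob(2) sets(2)] S(1)[OF prob(1)[of n] sets(1)[of n]] N by linarith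
  qed
qed

text \<open>Only lower bounds are available, so the matching upper bound comes from applying them to
  \<open>1 - F\<close>, where \<open>F\<close> is \<open>f\<close> rescaled to [0,1].\<close>

theorem weak_conv_topI:
  assumes prob: "\<And>n. prob_space (\<mu>s n)" "prob_space \<mu>"
    and sets: "\<And>n. sets (\<mu>s n) = sets borel" "sets \<mu> = sets borel"
    and conv: "\<And>g. g \<in> \<P> \<Longrightarrow> (\<lambda>n. \<integral>x. g x \<partial>\<mu>s n) \<longlonglongrightarrow> (\<integral>x. g x \<partial>\<mu>)"
  shows "weak_conv_top \<mu>s \<mu>"
  unfolding weak_conv_top_def
proof (intro allI impI)
  fix f :: "'a \<Rightarrow> real" assume f: "continuous_on UNIV f \<and> bounded (range f)"
  then obtain B where B: "B > 0" "\<And>x. \<bar>f x\<bar> \<le> B"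
    by (auto simp: bounded_pos)
  define F where "F x = (f x + B) / (2 * B)" for x
  have F: "continuous_on UNIV F" "\<And>x. 0 \<le> F x" "\<And>x. F x \<le> 1"
  proof -
    show "continuous_on UNIV F" using f B(1) unfolding F_def by (auto intro!: continuous_intros)
    show "0 \<le> F x" "F x \<le> 1" for x
      using B(1) B(2)[of x] unfolding F_def by (auto simp: divide_simps)
  qed
  have F': "continuous_on UNIV (\<lambda>x. 1 - F x)" "\<And>x. 0 \<le> 1 - F x" "\<And>x. 1 - F x \<le> 1"
    using F by (auto intro!: continuous_intros)
  have Fm: "F \<in> borel_measurable borel" using F(1) by (rule borel_measurable_continuous_onI)
  have iF: "integrable \<nu> F" and c: "(\<integral>x. 1 - F x \<partial>\<nu>) = 1 - (\<integral>x. F x \<partial>\<nu>)"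
     and fF: "(\<integral>x. f x \<partial>\<nu>) = 2 * B * (\<integral>x. F x \<partial>\<nu>) - B"
    if "prob_space \<nu>" "sets \<nu> = sets borel" for \<nu>
  proof -
    interpret prob_space \<nu> by fact
    show iF: "integrable \<nu> F"
      using F Fm by (intro integrable_const_bound[where B=1]) (auto simp: measurable_cong_sets[OF that(2) refl])
    show "(\<integral>x. 1 - F x \<partial>\<nu>) = 1 - (\<integral>x. F x \<partial>\<nu>)"
      using iF by (simp add: Bochner_Integration.integral_diff prob_space)
    have "f = (\<lambda>x. 2 * B * F x - B)" using B by (auto simp: F_def fun_eq_iff)
    then have "(\<integral>x. f x \<partial>\<nu>) = (\<integral>x. 2 * B * F x - B \<partial>\<nu>)" by simp
    also have "\<dots> = 2 * B * (\<integral>x. F x \<partial>\<nu>) - B"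
      using iF by (subst Bochner_Integration.integral_diff) (auto simp: prob_space)
    finally show "(\<integral>x. f x \<partial>\<nu>) = 2 * B * (\<integral>x. F x \<partial>\<nu>) - B" .
  qed
  have "(\<lambda>n. \<integral>x. F x \<partial>\<mu>s n) \<longlonglongrightarrow> (\<integral>x. F x \<partial>\<mu>)"
  proof (rule tendstoI)
    fix e :: real assume e: "e > 0"
    have "\<forall>\<^sub>F n in sequentially. (\<integral>x. F x \<partial>\<mu>s n) > (\<integral>x. F x \<partial>\<mu>) - e"
      by (rule eventually_integral_gt[OF prob sets conv F e])
    moreover have "\<forall>\<^sub>F n in sequentially. (\<integral>x. 1 - F x \<partial>\<mu>s n) > (\<integral>x. 1 - F x \<partial>\<mu>) - e"
      by (rule eventually_integral_gt[OF prob sets conv F' e])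
    ultimately show "\<forall>\<^sub>F n in sequentially. dist (\<integral>x. F x \<partial>\<mu>s n) (\<integral>x. F x \<partial>\<mu>) < e"
    proof eventually_elim
      case (elim n)
      then show ?case
        unfolding c[OF prob(1) sets(1)] c[OF prob(2) sets(2)] by (simp add: dist_real_def abs_less_iff)
    qed
  qed
  then show "(\<lambda>n. \<integral>x. f x \<partial>\<mu>s n) \<longlonglongrightarrow> (\<integral>x. f x \<partial>\<mu>)"
    unfolding fF[OF prob(1) sets(1)] fF[OF prob(2) sets(2)] by (intro tendsto_intros)
qed

text \<open>The bound on open sets, read for a constant sequence, compares two measures in either
  direction, and open sets form an intersection-stable generator.\<close>

theorem measure_eqI:
  assumes prob: "prob_space \<mu>" "prob_space \<nu>"
    and sets: "sets \<mu> = sets borel" "sets \<nu> = sets borel"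
    and eq: "\<And>g. g \<in> \<P> \<Longrightarrow> (\<integral>x. g x \<partial>\<mu>) = (\<integral>x. g x \<partial>\<nu>)"
  shows "\<mu> = \<nu>"
proof (rule measure_eqI_generator_eq)
  interpret mu: prob_space \<mu> by fact
  interpret nu: prob_space \<nu> by fact
  show "Int_stable {U :: 'a set. open U}" by (auto simp: Int_stable_def)
  show "sets \<mu> = sigma_sets UNIV {U. open U}" "sets \<nu> = sigma_sets UNIV {U. open U}"
    using sets by (auto simp: borel_def)
  fix U :: "'a set" assume "U \<in> {U. open U}"
  then have U: "open U" by simp
  have le: "measure \<mu>' U \<le> measure \<nu>' U"
    if "prob_space \<mu>'" "prob_space \<nu>'" "sets \<mu>' = sets borel" "sets \<nu>' = sets borel"
      "\<And>g. g \<in> \<P> \<Longrightarrow> (\<integral>x. g x \<partial>\<mu>') = (\<integral>x. g x \<partial>\<nu>')" for \<mu>' \<nu>'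
  proof (rule field_le_epsilon)
    fix e :: real assume "e > 0"
    then have "\<forall>\<^sub>F n in sequentially. measure \<nu>' U > measure \<mu>' U - e"
      using that by (intro eventually_measure_open_gt[OF _ _ _ _ _ U]) auto
    then show "measure \<mu>' U \<le> measure \<nu>' U + e" by simp
  qed
  have "measure \<mu> U = measure \<nu> U"
    by (intro antisym le prob sets eq eq[symmetric])
  then show "emeasure \<mu> U = emeasure \<nu> U"
    by (simp add: mu.emeasure_eq_measure nu.emeasure_eq_measure)
next
  show "range (\<lambda>_::nat. UNIV) \<subseteq> {U. open U}" by auto
  show "emeasure \<mu> UNIV \<noteq> \<infinity>"
    using prob_space.emeasure_space_1[OF prob(1)] sets_eq_imp_space_eq[OF sets(1)] by simp
qed auto

end

section \<open>Regular conditional distributions on Polish spaces\<close>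

text \<open>Base 4 with digits 0 and 1 only: the tail after any digit stays below one unit, so the floor
function recovers every digit, without the ambiguity of binary expansions.\<close>
definition digits_real :: "(nat \<Rightarrow> bool) \<Rightarrow> real" where
  "digits_real s = (\<Sum>q. of_bool (s q) / 4 ^ Suc q)"

definition real_digit :: "nat \<Rightarrow> real \<Rightarrow> bool" where
  "real_digit p y \<longleftrightarrow> \<lfloor>4 * ((\<lambda>y. frac (4 * y)) ^^ p) y\<rfloor> = 1"

lemma sums_quarter: "(\<lambda>q. 1 / 4 ^ Suc q :: real) sums (1 / 3)"
  using sums_mult[OF geometric_sums[of "1/4 :: real"], of "1/4"] by (simp add: power_one_over)

lemma summable_digits: "summable (\<lambda>q. of_bool (s q) / 4 ^ Suc q :: real)"
  by (rule summable_comparison_test'[OF sums_summable[OF sums_quarter], of 0]) auto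

lemma digits_real_nonneg: "0 \<le> digits_real s"
  unfolding digits_real_def by (intro suminf_nonneg summable_digits) auto

lemma digits_real_le: "digits_real s \<le> 1 / 3"
proof -
  have "digits_real s \<le> (\<Sum>q. 1 / 4 ^ Suc q :: real)"
    unfolding digits_real_def
    by (intro suminf_le summable_digits sums_summable[OF sums_quarter]) (auto simp: divide_right_mono)
  then show ?thesis using sums_unique[OF sums_quarter] by simp
qed

lemma digits_real_shift: "4 * digits_real s = of_bool (s 0) + digits_real (\<lambda>q. s (Suc q))"
proof -
  have "digits_real s = of_bool (s 0) / 4 + (\<Sum>q. of_bool (s (Suc q)) / 4 ^ Suc (Suc q))"
    unfolding digits_real_def using suminf_split_head[OF summable_digits[of s]] by simp
  moreover have "(\<Sum>q. of_bool (s (Suc q)) / 4 ^ Suc (Suc q)) = digits_real (\<lambda>q. s (Suc q)) / 4"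
    unfolding digits_real_def
    using suminf_divide[OF summable_digits[of "\<lambda>q. s (Suc q)"], of 4] by (simp add: field_simps)
  ultimately show ?thesis by simp
qed

lemma real_digit_digits_real: "real_digit p (digits_real s) \<longleftrightarrow> s p"
proof -
  have fl: "\<lfloor>4 * digits_real s\<rfloor> = of_bool (s 0)" for s
    unfolding digits_real_shift using digits_real_nonneg[of "\<lambda>q. s (Suc q)"] digits_real_le[of "\<lambda>q. s (Suc q)"]
    by (intro floor_unique) auto
  have fr: "frac (4 * digits_real s) = digits_real (\<lambda>q. s (Suc q))" for s
    unfolding frac_def fl by (simp add: digits_real_shift)
  have "((\<lambda>y. frac (4 * y)) ^^ p) (digits_real s) = digits_real (\<lambda>q. s (q + p))"
    by (induction p) (auto simp: fr)
  then show ?thesis unfolding real_digit_def by (simp add: fl)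
qed

lemma measurable_digits_real [measurable]:
  assumes [measurable]: "\<And>q. Measurable.pred N (\<lambda>x. b x q)"
  shows "(\<lambda>x. digits_real (b x)) \<in> borel_measurable N"
  unfolding digits_real_def of_bool_def by measurable

lemma measurable_real_digit [measurable]: "Measurable.pred borel (real_digit p)"
proof -
  have [measurable]: "(\<lambda>y::real. frac (4 * y)) \<in> borel_measurable borel"
    unfolding frac_def by measurable
  have [measurable]: "((\<lambda>y. frac (4 * y)) ^^ p) \<in> borel_measurable (borel :: real measure)"
    by (induction p) (auto simp: comp_def)
  show ?thesis unfolding real_digit_def by measurable
qed

text \<open>The digits of \<open>h x\<close> record which points of a dense sequence lie within \<open>2\<^sup>-\<^sup>n\<close> of \<open>x\<close>, and \<open>g\<close>
reads off a sequence of approximations and takes its limit. Only this left inverse is needed to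
transport kernels from the line, not a Borel isomorphism.\<close>
lemma borel_measurable_polish_retract_real:
  obtains h :: "'x::polish_space \<Rightarrow> real" and g :: "real \<Rightarrow> 'x"
  where "h \<in> borel_measurable borel" "g \<in> borel_measurable borel"
    "\<And>x. 0 \<le> h x" "\<And>x. h x < 1" "\<And>x. g (h x) = x"
proof -
  obtain D :: "'x set" where D: "countable D" "\<And>X. open X \<Longrightarrow> X \<noteq> {} \<Longrightarrow> \<exists>d\<in>D. d \<in> X"
    using countable_dense_setE by metis
  have "D \<noteq> {}" using D(2)[of UNIV] by auto
  define d where "d = from_nat_into D"
  have ran: "range d = D" unfolding d_def using D(1) \<open>D \<noteq> {}\<close> by simp
  have dense: "\<exists>k. dist x (d k) < e" if "e > 0" for x e
  proof -
    have "x \<in> ball x e" using that by simp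
    then obtain c where "c \<in> D" "c \<in> ball x e" using D(2)[OF open_ball] by blast
    then show ?thesis using ran by auto
  qed
  define b where "b x q \<longleftrightarrow> dist x (d (snd (prod_decode q))) < (1/2) ^ fst (prod_decode q)" for x q
  define h where "h x = digits_real (b x)" for x
  \<comment> \<open>At y = \<open>h x\<close> the least k exists by density. Elsewhere the digits
    may never be true, and \<open>LEAST\<close> then returns some unspecified index, which does not
    disturb measurability.\<close>
  define e where "e n y = d (LEAST k. real_digit (prod_encode (n, k)) y)" for n y
  \<comment> \<open>Off the range of \<open>h\<close> the approximations need not converge. The
    default \<open>d 0\<close> makes the sequence convergent at every real, so that its limit is
    measurable on the whole line.\<close>
  define e' where "e' n y = (if Cauchy (\<lambda>n. e n y) then e n y else d 0)" for n y
  have [measurable]: "e n \<in> borel_measurable borel" for n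
  proof -
    have "(\<lambda>y. LEAST k. real_digit (prod_encode (n, k)) y) \<in> borel \<rightarrow>\<^sub>M count_space UNIV"
      by measurable
    then show ?thesis unfolding e_def by (rule measurable_compose) simp
  qed
  have [measurable]: "Measurable.pred borel (\<lambda>y. Cauchy (\<lambda>n. e n y))"
    unfolding pred_def by measurable
  have e'_meas: "e' n \<in> borel_measurable borel" for n
    unfolding e'_def by measurable
  have "convergent (\<lambda>n. e' n y)" for y
    unfolding e'_def by (cases "Cauchy (\<lambda>n. e n y)") (auto simp: convergent_def Cauchy_convergent_iff)
  then have e'_lim: "(\<lambda>n. e' n y) \<longlonglongrightarrow> lim (\<lambda>n. e' n y)" for y
    by (simp add: convergent_LIMSEQ_iff)
  show ?thesis
  proof
    show "h \<in> borel_measurable borel" unfolding h_def b_def by measurable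
    show "(\<lambda>y. lim (\<lambda>n. e' n y)) \<in> borel_measurable borel"
      using e'_meas e'_lim by (rule borel_measurable_LIMSEQ_metric)
    show "0 \<le> h x" "h x < 1" for x
      unfolding h_def using digits_real_nonneg[of "b x"] digits_real_le[of "b x"] by auto
    show "lim (\<lambda>n. e' n (h x)) = x" for x
    proof -
      have "dist x (e n (h x)) < (1/2)^n" for n
        using LeastI_ex[OF dense[of "(1/2)^n" x]]
        by (simp add: e_def h_def real_digit_digits_real b_def)
      then have "dist (e n (h x)) x \<le> (1/2)^n" for n
        by (simp add: dist_commute less_imp_le)
      then have "(\<lambda>n. dist (e n (h x)) x) \<longlonglongrightarrow> 0"
        by (intro tendsto_sandwich[OF _ _ tendsto_const LIMSEQ_realpow_zero[of "1/2"]]) auto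
      then have lim: "(\<lambda>n. e n (h x)) \<longlonglongrightarrow> x" by (rule tendsto_dist_iff[THEN iffD2])
      then have "Cauchy (\<lambda>n. e n (h x))" by (rule LIMSEQ_imp_Cauchy)
      then show ?thesis using lim by (simp add: e'_def limI)
    qed
  qed
qed

section \<open>Conditional distributions as identities between weighted measures\<close>

lemma (in finite_measure_subalgebra) emeasure_bind_density_kernel:
  assumes K: "K \<in> measurable F (prob_algebra N)"
    and H: "H \<in> borel_measurable F" and A: "A \<in> sets N" and ne: "space M \<noteq> {}"
  shows "emeasure (density M H \<bind> K) A = (\<integral>\<^sup>+\<omega>. H \<omega> * emeasure (K \<omega>) A \<partial>M)"
proof -
  have K': "K \<in> measurable M (subprob_algebra N)"
    using measurable_from_subalg[OF subalg K] by (rule measurable_prob_algebraD)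
  have [measurable]: "H \<in> borel_measurable M" by (rule measurable_from_subalg[OF subalg H])
  have [measurable]: "(\<lambda>\<omega>. emeasure (K \<omega>) A) \<in> borel_measurable M"
    using measurable_emeasure_kernel[OF K' A] .
  show ?thesis
    using ne A K' by (subst emeasure_bind[where N=N]) (auto simp: nn_integral_density)
qed

lemma (in finite_measure_subalgebra) reg_cond_distr_kernel_eq:
  assumes K: "reg_cond_distr M F Y K" and Y: "Y \<in> borel_measurable M"
    and H: "H \<in> borel_measurable F" "\<And>\<omega>. 0 \<le> H \<omega>" "\<And>\<omega>. H \<omega> \<le> (1::real)" and ne: "space M \<noteq> {}"
  shows "distr (density M H) borel Y = density M H \<bind> K"
proof (rule measure_eqI)
  have K1: "K \<in> measurable F (prob_algebra borel)" using K by (simp add: reg_cond_distr_def)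
  have K': "K \<in> measurable M (prob_algebra borel)" by (rule measurable_from_subalg[OF subalg K1])
  note Km = measurable_prob_algebraD[OF K']
  have [measurable]: "H \<in> borel_measurable M" by (rule measurable_from_subalg[OF subalg H(1)])
  note [measurable] = Y
  show sets: "sets (distr (density M H) borel Y) = sets (density M H \<bind> K)"
    using ne Km by (subst sets_bind[where N=borel]) (auto dest: measurable_space simp: space_subprob_algebra)
  fix A assume "A \<in> sets (distr (density M H) borel Y)"
  then have A[measurable]: "A \<in> sets borel" by simp
  have [measurable]: "(\<lambda>\<omega>. measure (K \<omega>) A) \<in> borel_measurable M"
    using measurable_emeasure_kernel[OF Km A] by (simp add: measure_def)
  have Kp: "prob_space (K \<omega>)" if "\<omega> \<in> space M" for \<omega>
    using measurable_space[OF K' that] by (simp add: space_prob_algebra)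
  have i1: "integrable M (\<lambda>\<omega>. H \<omega> * indicator A (Y \<omega>))"
    using H by (intro integrable_const_bound[where B=1]) (auto simp: indicator_def)
  have i2: "integrable M (\<lambda>\<omega>. H \<omega> * measure (K \<omega>) A)"
    using H prob_space.prob_le_1[OF Kp]
    by (intro integrable_const_bound[where B=1]) (auto simp: abs_mult intro!: mult_le_one)
  have "emeasure (distr (density M H) borel Y) A = (\<integral>\<^sup>+\<omega>. ennreal (H \<omega> * indicator A (Y \<omega>)) \<partial>M)"
    using measurable_sets[OF Y A]
    by (auto simp: emeasure_distr emeasure_density H ennreal_mult indicator_def intro!: nn_integral_cong)
  also have "\<dots> = ennreal (\<integral>\<omega>. H \<omega> * indicator A (Y \<omega>) \<partial>M)"
    using i1 H by (intro nn_integral_eq_integral) auto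
  also have "(\<integral>\<omega>. H \<omega> * indicator A (Y \<omega>) \<partial>M) = (\<integral>\<omega>. H \<omega> * real_cond_exp M F (\<lambda>\<omega>. indicator A (Y \<omega>)) \<omega> \<partial>M)"
    using i1 H by (intro real_cond_exp_intg(2)[symmetric]) auto
  also have "\<dots> = (\<integral>\<omega>. H \<omega> * measure (K \<omega>) A \<partial>M)"
  proof (rule integral_cong_AE)
    have "AE \<omega> in M. measure (K \<omega>) A = real_cond_exp M F (\<lambda>\<omega>. indicator A (Y \<omega>)) \<omega>"
      using K A unfolding reg_cond_distr_def by blast
    then show "AE \<omega> in M. H \<omega> * real_cond_exp M F (\<lambda>\<omega>. indicator A (Y \<omega>)) \<omega> = H \<omega> * measure (K \<omega>) A"
      by eventually_elim simp
  qed auto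
  also have "ennreal \<dots> = (\<integral>\<^sup>+\<omega>. ennreal (H \<omega> * measure (K \<omega>) A) \<partial>M)"
    using i2 H by (intro nn_integral_eq_integral[symmetric]) auto
  also have "\<dots> = (\<integral>\<^sup>+\<omega>. ennreal (H \<omega>) * emeasure (K \<omega>) A \<partial>M)"
    using H finite_measure.emeasure_eq_measure[OF prob_space.finite_measure[OF Kp]]
    by (intro nn_integral_cong) (auto simp: ennreal_mult)
  also have "\<dots> = emeasure (density M H \<bind> K) A"
    using H ne by (intro emeasure_bind_density_kernel[OF K1 _ A, symmetric]) auto
  finally show "emeasure (distr (density M H) borel Y) A = emeasure (density M H \<bind> K) A" .
qed

text \<open>Both sides integrate \<open>f\<close> against the two equal measures of
  \<open>reg_cond_distr_kernel_eq\<close>, so no approximation of \<open>f\<close> by simple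
  functions is required here.\<close>

lemma (in finite_measure_subalgebra) reg_cond_distr_integral:
  fixes f :: "'x::topological_space \<Rightarrow> real"
  assumes K: "reg_cond_distr M F Y K" and Y: "Y \<in> borel_measurable M"
    and H: "H \<in> borel_measurable F" "\<And>\<omega>. 0 \<le> H \<omega>" "\<And>\<omega>. H \<omega> \<le> (1::real)"
    and f: "f \<in> borel_measurable borel" "\<And>x. 0 \<le> f x" "\<And>x. f x \<le> 1" and ne: "space M \<noteq> {}"
  shows "(\<integral>\<omega>. H \<omega> * f (Y \<omega>) \<partial>M) = (\<integral>\<omega>. H \<omega> * (\<integral>x. f x \<partial>K \<omega>) \<partial>M)"
proof -
  have K1: "K \<in> measurable F (prob_algebra borel)" using K by (simp add: reg_cond_distr_def)
  have K': "K \<in> measurable M (prob_algebra borel)" by (rule measurable_from_subalg[OF subalg K1])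
  note Km[measurable] = measurable_prob_algebraD[OF K']
  have Hm[measurable]: "H \<in> borel_measurable M" by (rule measurable_from_subalg[OF subalg H(1)])
  note [measurable] = Y f(1)
  have Kp: "prob_space (K \<omega>)" "sets (K \<omega>) = sets borel" if "\<omega> \<in> space M" for \<omega>
    using measurable_space[OF K' that] by (auto simp: space_prob_algebra)
  have intK: "integrable (K \<omega>) f" if "\<omega> \<in> space M" for \<omega>
  proof -
    interpret prob_space "K \<omega>" by (rule Kp[OF that])
    show ?thesis using f
      by (intro integrable_const_bound[where B=1]) (auto simp: measurable_cong_sets[OF Kp(2)[OF that] refl])
  qed
  have nnK: "(\<integral>\<^sup>+x. f x \<partial>K \<omega>) = ennreal (\<integral>x. f x \<partial>K \<omega>)" if "\<omega> \<in> space M" for \<omega>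
    using intK[OF that] f by (intro nn_integral_eq_integral) auto
  have I1: "(\<integral>x. f x \<partial>K \<omega>) \<le> 1" if "\<omega> \<in> space M" for \<omega>
    using prob_space.integral_le_const[OF Kp(1)[OF that] intK[OF that], of 1] f by auto
  have [measurable]: "(\<lambda>\<omega>. \<integral>x. f x \<partial>K \<omega>) \<in> borel_measurable M"
    by measurable
  have i1: "integrable M (\<lambda>\<omega>. H \<omega> * f (Y \<omega>))"
    using H f by (intro integrable_const_bound[where B=1]) (auto simp: abs_mult intro!: mult_le_one)
  have i2: "integrable M (\<lambda>\<omega>. H \<omega> * (\<integral>x. f x \<partial>K \<omega>))"
    using H f I1 by (intro integrable_const_bound[where B=1]) (auto simp: abs_mult intro!: mult_le_one)
  have "ennreal (\<integral>\<omega>. H \<omega> * f (Y \<omega>) \<partial>M) = (\<integral>\<^sup>+\<omega>. ennreal (H \<omega> * f (Y \<omega>)) \<partial>M)"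
    using i1 H f by (intro nn_integral_eq_integral[symmetric]) auto
  also have "\<dots> = (\<integral>\<^sup>+x. f x \<partial>distr (density M H) borel Y)"
    using H f by (simp add: nn_integral_distr nn_integral_density ennreal_mult)
  also have "\<dots> = (\<integral>\<^sup>+x. f x \<partial>(density M H \<bind> K))"
    by (simp add: reg_cond_distr_kernel_eq[OF K Y H ne])
  also have "\<dots> = (\<integral>\<^sup>+\<omega>. \<integral>\<^sup>+x. f x \<partial>K \<omega> \<partial>density M H)"
    by (rule nn_integral_bind[where B=borel]) auto
  also have "\<dots> = (\<integral>\<^sup>+\<omega>. ennreal (H \<omega>) * \<integral>\<^sup>+x. f x \<partial>K \<omega> \<partial>M)"
    by (subst nn_integral_density) auto
  also have "\<dots> = (\<integral>\<^sup>+\<omega>. ennreal (H \<omega> * (\<integral>x. f x \<partial>K \<omega>)) \<partial>M)"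
    using H f by (intro nn_integral_cong) (simp add: nnK ennreal_mult)
  also have "\<dots> = ennreal (\<integral>\<omega>. H \<omega> * (\<integral>x. f x \<partial>K \<omega>) \<partial>M)"
    using i2 H f by (intro nn_integral_eq_integral) auto
  finally show ?thesis
    using H f by (subst (asm) ennreal_inj) (auto intro!: integral_nonneg_AE)
qed

text \<open>The converse direction: indicator weights suffice, as conditional expectations are
  characterised by integrals over the sets of \<open>F\<close>. An equality of measures can then be
  checked on half-lines only.\<close>

lemma (in finite_measure_subalgebra) reg_cond_distrI:
  assumes K: "K \<in> measurable F (prob_algebra borel)" and Y: "Y \<in> borel_measurable M"
    and eq: "\<And>B. B \<in> sets F \<Longrightarrow> distr (density M (indicator B)) borel Y = density M (indicator B) \<bind> K"
    and ne: "space M \<noteq> {}"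
  shows "reg_cond_distr M F Y K"
  unfolding reg_cond_distr_def
proof (intro conjI ballI K)
  fix A :: "'b set" assume A[measurable]: "A \<in> sets borel"
  have K': "K \<in> measurable M (prob_algebra borel)" by (rule measurable_from_subalg[OF subalg K])
  note [measurable] = Y
  have Kp: "prob_space (K \<omega>)" if "\<omega> \<in> space M" for \<omega>
    using measurable_space[OF K' that] by (simp add: space_prob_algebra)
  have F_meas: "(\<lambda>\<omega>. measure (K \<omega>) A) \<in> borel_measurable F"
    using measurable_emeasure_kernel[OF measurable_prob_algebraD[OF K] A] by (simp add: measure_def)
  then have M_meas[measurable]: "(\<lambda>\<omega>. measure (K \<omega>) A) \<in> borel_measurable M"
    by (rule measurable_from_subalg[OF subalg])
  have i2: "integrable M (\<lambda>\<omega>. measure (K \<omega>) A)"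
    using prob_space.prob_le_1[OF Kp] by (intro integrable_const_bound[where B=1]) auto
  have i1: "integrable M (\<lambda>\<omega>. indicator A (Y \<omega>) :: real)"
    by (intro integrable_const_bound[where B=1]) (auto simp: indicator_def)
  have "AE \<omega> in M. real_cond_exp M F (\<lambda>\<omega>. indicator A (Y \<omega>)) \<omega> = measure (K \<omega>) A"
  proof (rule real_cond_exp_charact[OF _ i1 i2 F_meas])
    fix B assume B: "B \<in> sets F"
    then have [measurable]: "B \<in> sets M" using subalg by (auto simp: subalgebra_def)
    have "ennreal (\<integral>\<omega>\<in>B. indicator A (Y \<omega>) \<partial>M) = (\<integral>\<^sup>+\<omega>. ennreal (indicator B \<omega> * indicator A (Y \<omega>)) \<partial>M)"
      using integrable_mult_indicator[OF \<open>B \<in> sets M\<close> i1] unfolding set_lebesgue_integral_def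
      by (subst nn_integral_eq_integral) auto
    also have "\<dots> = emeasure (distr (density M (indicator B)) borel Y) A"
      using measurable_sets[OF Y A]
      by (auto simp: emeasure_distr emeasure_density ennreal_mult indicator_def intro!: nn_integral_cong)
    also have "\<dots> = (\<integral>\<^sup>+\<omega>. indicator B \<omega> * emeasure (K \<omega>) A \<partial>M)"
      unfolding eq[OF B] using B by (intro emeasure_bind_density_kernel[OF K _ A ne]) auto
    also have "\<dots> = (\<integral>\<^sup>+\<omega>. ennreal (indicator B \<omega> * measure (K \<omega>) A) \<partial>M)"
      using finite_measure.emeasure_eq_measure[OF prob_space.finite_measure[OF Kp]]
      by (intro nn_integral_cong) (auto simp: indicator_def)
    also have "\<dots> = ennreal (\<integral>\<omega>\<in>B. measure (K \<omega>) A \<partial>M)"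
      using integrable_mult_indicator[OF \<open>B \<in> sets M\<close> i2] unfolding set_lebesgue_integral_def
      by (subst nn_integral_eq_integral) auto
    finally show "(\<integral>\<omega>\<in>B. indicator A (Y \<omega>) \<partial>M) = (\<integral>\<omega>\<in>B. measure (K \<omega>) A \<partial>M)"
      by (subst (asm) ennreal_inj) (auto simp: set_lebesgue_integral_def intro!: integral_nonneg_AE)
  qed
  then show "AE \<omega> in M. measure (K \<omega>) A = real_cond_exp M F (\<lambda>\<omega>. indicator A (Y \<omega>)) \<omega>"
    by (auto elim: AE_mp)
qed

text \<open>Whatever the bounded function \<open>c\<close> is, \<open>rat_inf c\<close> is monotone and right-continuous. Hence versions of
conditional probabilities can be turned into distribution functions without discarding null sets.\<close>
definition rat_inf :: "(real \<Rightarrow> real) \<Rightarrow> real \<Rightarrow> real" where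
  "rat_inf c x = (INF q\<in>{q\<in>\<rat>. x < q}. c q)"

lemma rat_greater_ne: "{q\<in>\<rat>. (x::real) < q} \<noteq> {}"
  using Rats_dense_in_real[of x "x + 1"] by auto

lemma rat_inf_lower: "(\<And>q. 0 \<le> c q) \<Longrightarrow> q \<in> \<rat> \<Longrightarrow> x < q \<Longrightarrow> rat_inf c x \<le> c q"
  unfolding rat_inf_def by (intro cINF_lower bdd_belowI2[of _ 0]) auto

lemma rat_inf_greatest: "(\<And>q. q \<in> \<rat> \<Longrightarrow> x < q \<Longrightarrow> m \<le> c q) \<Longrightarrow> m \<le> rat_inf c x"
  unfolding rat_inf_def by (intro cINF_greatest rat_greater_ne) auto

text \<open>The prescribed values of \<open>c\<close> outside [0,1) make \<open>rat_inf c\<close>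
  constant far out on both sides, which supplies the limits 0 and 1 of a distribution
  function.\<close>

lemma real_distribution_rat_inf:
  assumes c: "\<And>q. 0 \<le> c q" "\<And>q. q < 0 \<Longrightarrow> c q = 0" "\<And>q. 1 \<le> q \<Longrightarrow> c q = 1"
  shows "real_distribution (interval_measure (rat_inf c))" "cdf (interval_measure (rat_inf c)) = rat_inf c"
proof -
  have mono: "rat_inf c x \<le> rat_inf c y" if "x \<le> y" for x y
    using that c by (intro rat_inf_greatest rat_inf_lower) auto
  have cont: "continuous (at_right a) (rat_inf c)" for a
    unfolding continuous_within
  proof (rule order_tendstoI)
    fix l assume l: "l < rat_inf c a"
    show "\<forall>\<^sub>F x in at_right a. l < rat_inf c x"
      using eventually_at_right_less[of a] by eventually_elim (rule less_le_trans[OF l mono[OF less_imp_le]])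
  next
    fix u assume "rat_inf c a < u"
    \<comment> \<open>A single rational \<open>q\<close> to the right of \<open>a\<close> with
      \<open>c q < u\<close> bounds \<open>rat_inf c\<close> on the whole interval from
      \<open>a\<close> to \<open>q\<close>, which is right-continuity.\<close>
    then obtain q where q: "q \<in> \<rat>" "a < q" "c q < u"
      using rat_inf_greatest[of a u c] by (meson not_le)
    show "\<forall>\<^sub>F x in at_right a. rat_inf c x < u"
      using eventually_at_right_real[OF q(2)]
    proof eventually_elim
      case (elim x)
      then have "rat_inf c x \<le> c q" by (intro rat_inf_lower c q) simp
      then show ?case using q(3) by simp
    qed
  qed
  have nn: "0 \<le> rat_inf c x" for x using c by (intro rat_inf_greatest) auto
  have "rat_inf c x = 0" if "x < -1" for x
  proof -
    have "x < 0" using that by simp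
    from Rats_dense_in_real[OF this] obtain q where q: "q \<in> \<rat>" "x < q" "q < 0" by blast
    have "rat_inf c x \<le> c q" by (intro rat_inf_lower c q)
    then show ?thesis using c(2)[OF q(3)] nn[of x] by simp
  qed
  then have bot: "(rat_inf c \<longlongrightarrow> 0) at_bot"
    by (intro tendsto_eventually) (auto simp: eventually_at_bot_dense)
  have "rat_inf c x = 1" if "x > 1" for x
  proof (rule antisym)
    obtain q where q: "q \<in> \<rat>" "x < q" using Rats_dense_in_real[of x "x + 1"] by auto
    have "rat_inf c x \<le> c q" by (intro rat_inf_lower c q)
    then show "rat_inf c x \<le> 1" using c(3)[of q] q that by simp
    show "1 \<le> rat_inf c x" using that c(3) by (intro rat_inf_greatest) auto
  qed
  then have top: "(rat_inf c \<longlongrightarrow> 1) at_top"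
    by (intro tendsto_eventually) (auto simp: eventually_at_top_dense)
  show "real_distribution (interval_measure (rat_inf c))"
    by (rule real_distribution_interval_measure[OF mono cont bot top])
  show "cdf (interval_measure (rat_inf c)) = rat_inf c"
    by (rule cdf_interval_measure[OF mono cont bot])
qed

text \<open>The distribution function \<open>D \<omega>\<close> is assembled from the conditional
  probabilities of half-lines at rational points. Values of \<open>Y\<close> in [0,1) allow its
  tails to be fixed exactly, for every \<omega>.\<close>

lemma (in prob_space) reg_cond_distr_exists_real:
  assumes sub: "subalgebra M F" and Y: "Y \<in> borel_measurable M"
    and Y01: "\<And>\<omega>. 0 \<le> Y \<omega>" "\<And>\<omega>. Y \<omega> < (1::real)"
  shows "\<exists>K. reg_cond_distr M F Y K"
proof -
  interpret finite_measure_subalgebra M F by standard (rule sub)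
  note [measurable] = Y
  define E where "E q \<omega> = real_cond_exp M F (\<lambda>\<omega>. indicator {..q} (Y \<omega>)) \<omega>" for q \<omega>
  \<comment> \<open>Clamping and the forced values change \<open>E q\<close> on a null set only, but
    make \<open>C \<omega>\<close> meet the assumptions of \<open>real_distribution_rat_inf\<close>
    for every \<omega>.\<close>
  define C where "C \<omega> q = (if q < 0 then 0 else if 1 \<le> q then 1 else max 0 (min 1 (E q \<omega>)))" for \<omega> q
  define D where "D \<omega> = rat_inf (C \<omega>)" for \<omega>
  have int: "integrable M (\<lambda>\<omega>. indicator {..q} (Y \<omega>) :: real)" for q
    by (intro integrable_const_bound[where B=1]) (auto simp: indicator_def)
  have EF: "E q \<in> borel_measurable F" for q unfolding E_def by simp
  have C: "0 \<le> C \<omega> q" "C \<omega> q \<le> 1" "q < 0 \<Longrightarrow> C \<omega> q = 0" "1 \<le> q \<Longrightarrow> C \<omega> q = 1" for \<omega> q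
    unfolding C_def by auto
  have C_eq: "AE \<omega> in M. C \<omega> q = E q \<omega>" for q
  proof -
    consider "q < 0" | "1 \<le> q" | "0 \<le> q" "q < 1" by linarith
    then show ?thesis
    proof cases
      case 1
      have "\<not> Y \<omega> \<le> q" for \<omega> using 1 Y01(1)[of \<omega>] by linarith
      then have "(\<lambda>\<omega>. indicator {..q} (Y \<omega>) :: real) = (\<lambda>_. 0)"
        by (simp add: fun_eq_iff)
      then have "AE \<omega> in M. E q \<omega> = 0"
        unfolding E_def using real_cond_exp_F_meas[of "\<lambda>_. 0"] by simp
      then show ?thesis by eventually_elim (use 1 in \<open>simp add: C_def\<close>)
    next
      case 2
      have "Y \<omega> \<le> q" for \<omega> using 2 Y01(2)[of \<omega>] by linarith
      then have "(\<lambda>\<omega>. indicator {..q} (Y \<omega>) :: real) = (\<lambda>_. 1)"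
        by (simp add: fun_eq_iff)
      then have "AE \<omega> in M. E q \<omega> = 1"
        unfolding E_def using real_cond_exp_F_meas[of "\<lambda>_. 1"] by simp
      then show ?thesis by eventually_elim (use 2 in \<open>simp add: C_def\<close>)
    next
      case 3
      have "AE \<omega> in M. 0 \<le> E q \<omega>" unfolding E_def by (rule real_cond_exp_pos) auto
      moreover have "AE \<omega> in M. E q \<omega> \<le> 1"
        unfolding E_def using real_cond_exp_le_c[OF int, of q 1] by (auto simp: indicator_def)
      ultimately show ?thesis by eventually_elim (use 3 in \<open>simp add: C_def\<close>)
    qed
  qed
  have CF: "(\<lambda>\<omega>. C \<omega> q) \<in> borel_measurable F" for q
    using EF[of q] unfolding C_def by measurable
  have DF: "(\<lambda>\<omega>. D \<omega> x) \<in> borel_measurable F" for x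
    unfolding D_def rat_inf_def using CF
    by (intro borel_measurable_cINF_real) (auto intro: countable_subset[OF _ countable_rat])
  have D01: "0 \<le> D \<omega> x" "D \<omega> x \<le> 1" for \<omega> x
  proof -
    show "0 \<le> D \<omega> x" unfolding D_def by (intro rat_inf_greatest C)
    obtain q where q: "q \<in> \<rat>" "x < q" using Rats_dense_in_real[of x "x + 1"] by auto
    have "D \<omega> x \<le> C \<omega> q" unfolding D_def by (intro rat_inf_lower C q)
    then show "D \<omega> x \<le> 1" using C(2)[of \<omega> q] by (rule order_trans)
  qed
  have DM[measurable]: "(\<lambda>\<omega>. D \<omega> x) \<in> borel_measurable M" for x
    by (rule measurable_from_subalg[OF subalg DF])
  have intD: "integrable M (\<lambda>\<omega>. D \<omega> x)" for x
    using D01 by (intro integrable_const_bound[where B=1]) auto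
  have intE: "integrable M (E x)" and intE_eq: "(\<integral>\<omega>. E x \<omega> \<partial>M) = prob (Y -` {..x} \<inter> space M)" for x
  proof -
    show "integrable M (E x)" unfolding E_def by (rule real_cond_exp_int(1)[OF int])
    have "(\<integral>\<omega>. E x \<omega> \<partial>M) = (\<integral>\<omega>. indicator {..x} (Y \<omega>) \<partial>M)"
      unfolding E_def by (rule real_cond_exp_int(2)[OF int])
    also have "\<dots> = (\<integral>\<omega>. indicator (Y -` {..x} \<inter> space M) \<omega> \<partial>M)"
      by (intro Bochner_Integration.integral_cong) (auto simp: indicator_def)
    also have "\<dots> = prob (Y -` {..x} \<inter> space M)" by simp
    finally show "(\<integral>\<omega>. E x \<omega> \<partial>M) = prob (Y -` {..x} \<inter> space M)" .
  qed
  \<comment> \<open>Monotonicity over countably many rationals gives \<open>E x\<close> \<le>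
    \<open>D x\<close> almost everywhere. Equality follows because the integral of
    \<open>D x\<close> does not exceed that of \<open>E x\<close>.\<close>
  have D_eq: "AE \<omega> in M. D \<omega> x = E x \<omega>" for x
  proof -
    have "AE \<omega> in M. \<forall>q\<in>{q\<in>\<rat>. x < q}. E x \<omega> \<le> C \<omega> q"
    proof (subst AE_ball_countable, safe)
      show "countable {q\<in>\<rat>. x < q}" by (auto intro: countable_subset[OF _ countable_rat])
      fix q :: real assume "x < q"
      then have "AE \<omega> in M. E x \<omega> \<le> E q \<omega>"
        unfolding E_def using int by (intro real_cond_exp_mono) (auto simp: indicator_def)
      with C_eq[of q] show "AE \<omega> in M. E x \<omega> \<le> C \<omega> q" by eventually_elim simp
    qed
    then have ge: "AE \<omega> in M. E x \<omega> \<le> D \<omega> x"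
      unfolding D_def by eventually_elim (auto intro: rat_inf_greatest)
    have "(\<integral>\<omega>. D \<omega> x \<partial>M) \<le> prob (Y -` {..x} \<inter> space M)"
    proof -
      interpret dY: real_distribution "distr M borel Y" by simp
      have cdf: "cdf (distr M borel Y) y = prob (Y -` {..y} \<inter> space M)" for y
        by (simp add: cdf_def2 measure_distr)
      \<comment> \<open>A rational q between x and y links \<open>D x\<close> to the distribution
        function of \<open>Y\<close>. Letting y decrease to x then uses the right-continuity of that
        function.\<close>
      have le: "(\<integral>\<omega>. D \<omega> x \<partial>M) \<le> cdf (distr M borel Y) y" if xy: "x < y" for y
      proof -
        obtain q where q: "q \<in> \<rat>" "x < q" "q < y" using Rats_dense_in_real[OF xy] by auto
        have "(\<integral>\<omega>. D \<omega> x \<partial>M) \<le> (\<integral>\<omega>. E q \<omega> \<partial>M)"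
        proof (rule integral_mono_AE[OF intD intE])
          have DC: "D \<omega> x \<le> C \<omega> q" for \<omega> unfolding D_def by (intro rat_inf_lower C q)
          show "AE \<omega> in M. D \<omega> x \<le> E q \<omega>"
            using C_eq[of q]
          proof eventually_elim
            case (elim \<omega>)
            then show ?case using DC[of \<omega>] by simp
          qed
        qed
        also have "\<dots> = cdf (distr M borel Y) q" by (simp add: intE_eq cdf)
        also have "\<dots> \<le> cdf (distr M borel Y) y" using q by (intro dY.cdf_nondecreasing) simp
        finally show ?thesis .
      qed
      have "(cdf (distr M borel Y) \<longlongrightarrow> cdf (distr M borel Y) x) (at_right x)"
        using dY.cdf_is_right_cont[of x] by (simp add: continuous_within)
      moreover have "\<forall>\<^sub>F y in at_right x. (\<integral>\<omega>. D \<omega> x \<partial>M) \<le> cdf (distr M borel Y) y"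
        using eventually_at_right_less[of x] by eventually_elim (rule le)
      ultimately have "(\<integral>\<omega>. D \<omega> x \<partial>M) \<le> cdf (distr M borel Y) x"
        by (rule tendsto_lowerbound) simp
      then show ?thesis by (simp add: cdf)
    qed
    then have "(\<integral>\<omega>. D \<omega> x - E x \<omega> \<partial>M) \<le> 0"
      using intD intE by (simp add: intE_eq)
    moreover have "0 \<le> (\<integral>\<omega>. D \<omega> x - E x \<omega> \<partial>M)"
      using ge by (intro integral_nonneg_AE) auto
    ultimately have "AE \<omega> in M. D \<omega> x - E x \<omega> = 0"
      using ge intD intE by (subst integral_nonneg_eq_0_iff_AE[symmetric]) auto
    then show ?thesis by eventually_elim simp
  qed
  define K where "K \<omega> = interval_measure (D \<omega>)" for \<omega>
  have K: "real_distribution (K \<omega>)" "cdf (K \<omega>) = D \<omega>" for \<omega>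
    unfolding K_def D_def using C by (auto intro!: real_distribution_rat_inf)
  have K_atMost: "emeasure (K \<omega>) {..x} = ennreal (D \<omega> x)" for \<omega> x
  proof -
    interpret K: real_distribution "K \<omega>" by (rule K)
    show ?thesis by (simp add: K.emeasure_eq_measure K(2)[symmetric] cdf_def2)
  qed
  have K_meas: "K \<in> measurable F (prob_algebra borel)"
  proof (rule measurable_prob_algebra_generated[where G="range atMost" and \<Omega>=UNIV])
    show "sets borel = sigma_sets UNIV (range (atMost :: real \<Rightarrow> _))"
      by (subst borel_eq_atMost) (auto simp: sets_measure_of)
    show "Int_stable (range (atMost :: real \<Rightarrow> _))"
      by (auto simp: Int_stable_def)
    show "prob_space (K \<omega>)" "sets (K \<omega>) = sets borel" for \<omega>
      using K(1)[of \<omega>] by (auto simp: real_distribution_def real_distribution_axioms_def)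
    show "(\<lambda>\<omega>. emeasure (K \<omega>) A) \<in> borel_measurable F" if "A \<in> range atMost" for A
      using that DF by (auto simp: K_atMost)
  qed auto
  have "reg_cond_distr M F Y K"
  proof (rule reg_cond_distrI[OF K_meas Y _ not_empty])
    fix B assume B: "B \<in> sets F"
    then have [measurable]: "B \<in> sets M" using subalg by (auto simp: subalgebra_def)
    have BF: "indicator B \<in> borel_measurable F" using B by simp
    have Km: "K \<in> measurable M (subprob_algebra borel)"
      using measurable_from_subalg[OF subalg K_meas] by (rule measurable_prob_algebraD)
    let ?N1 = "distr (density M (indicator B)) borel Y"
    let ?N2 = "density M (indicator B) \<bind> K"
    have eq: "emeasure ?N1 {..x} = emeasure ?N2 {..x}" for x
    proof -
      have i: "integrable M (\<lambda>\<omega>. indicator B \<omega> * indicator {..x} (Y \<omega>) :: real)"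
        using integrable_mult_indicator[OF \<open>B \<in> sets M\<close> int] by simp
      have "emeasure ?N1 {..x} = (\<integral>\<^sup>+\<omega>. ennreal (indicator B \<omega> * indicator {..x} (Y \<omega>)) \<partial>M)"
        using measurable_sets[OF Y, of "{..x}"]
        by (auto simp: emeasure_distr emeasure_density indicator_def intro!: nn_integral_cong)
      also have "\<dots> = ennreal (\<integral>\<omega>. indicator B \<omega> * indicator {..x} (Y \<omega>) \<partial>M)"
        using i by (intro nn_integral_eq_integral) auto
      also have "(\<integral>\<omega>. indicator B \<omega> * indicator {..x} (Y \<omega>) \<partial>M) = (\<integral>\<omega>. indicator B \<omega> * E x \<omega> \<partial>M)"
        unfolding E_def using i BF by (intro real_cond_exp_intg(2)[symmetric]) auto
      also have "\<dots> = (\<integral>\<omega>. indicator B \<omega> * D \<omega> x \<partial>M)"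
        using D_eq[of x] by (intro integral_cong_AE) (auto simp: E_def)
      also have "ennreal \<dots> = (\<integral>\<^sup>+\<omega>. ennreal (indicator B \<omega> * D \<omega> x) \<partial>M)"
        using integrable_mult_indicator[OF \<open>B \<in> sets M\<close> intD[of x]] D01
        by (intro nn_integral_eq_integral[symmetric]) auto
      also have "\<dots> = (\<integral>\<^sup>+\<omega>. indicator B \<omega> * emeasure (K \<omega>) {..x} \<partial>M)"
        by (intro nn_integral_cong) (auto simp: K_atMost indicator_def)
      also have "\<dots> = emeasure ?N2 {..x}"
        using B by (intro emeasure_bind_density_kernel[OF K_meas _ _ not_empty, symmetric]) auto
      finally show ?thesis .
    qed
    have s2: "sets ?N2 = sets borel"
      using Km not_empty by (subst sets_bind[where N=borel]) (auto dest: measurable_space simp: space_subprob_algebra)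
    \<comment> \<open>Both measures have the mass of \<open>B\<close>, which may be less than 1, so
      uniqueness is invoked for finite Borel measures.\<close>
    show "?N1 = ?N2"
    proof (rule cdf_unique')
      have f1: "finite_measure ?N1"
      proof
        show "emeasure ?N1 (space ?N1) \<noteq> \<infinity>" by (simp add: emeasure_distr emeasure_density)
      qed
      then show "finite_borel_measure ?N1"
        by (auto simp: finite_borel_measure_def finite_borel_measure_axioms_def)
      show "finite_borel_measure ?N2"
        unfolding finite_borel_measure_def finite_borel_measure_axioms_def
      proof (intro conjI s2)
        have "subprob_space (density M (indicator B))"
        proof
          show "emeasure (density M (indicator B)) (space (density M (indicator B))) \<le> 1"
            using emeasure_space[of M B] emeasure_space_1 by (simp add: emeasure_density)
          show "space (density M (indicator B)) \<noteq> {}" using not_empty by simp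
        qed
        then have "subprob_space ?N2" using Km by (intro subprob_space_bind) auto
        then show "finite_measure ?N2" by (simp add: subprob_space_def)
      qed
      show "cdf ?N1 = cdf ?N2" using eq by (simp add: fun_eq_iff cdf_def2 measure_def)
    qed
  qed
  then show ?thesis by blast
qed

text \<open>Since \<open>Y\<close> = \<open>g\<close> (\<open>h Y\<close>), the image under
  \<open>g\<close> of a conditional distribution of the real variable \<open>h Y\<close> is one of
  \<open>Y\<close>.\<close>

theorem (in prob_space) reg_cond_distr_exists:
  fixes Y :: "'a \<Rightarrow> 'x::polish_space"
  assumes sub: "subalgebra M F" and Y: "Y \<in> borel_measurable M"
  shows "\<exists>K. reg_cond_distr M F Y K"
proof -
  obtain h :: "'x \<Rightarrow> real" and g :: "real \<Rightarrow> 'x"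
    where h[measurable]: "h \<in> borel_measurable borel" and g[measurable]: "g \<in> borel_measurable borel"
      and h01: "\<And>x. 0 \<le> h x" "\<And>x. h x < 1" and gh: "\<And>x. g (h x) = x"
    using borel_measurable_polish_retract_real by blast
  have "(\<lambda>\<omega>. h (Y \<omega>)) \<in> borel_measurable M" using Y by measurable
  from reg_cond_distr_exists_real[OF sub this h01]
  obtain K where K: "K \<in> measurable F (prob_algebra borel)"
    "\<And>A. A \<in> sets borel \<Longrightarrow> AE \<omega> in M. measure (K \<omega>) A = real_cond_exp M F (\<lambda>\<omega>. indicator A (h (Y \<omega>))) \<omega>"
    unfolding reg_cond_distr_def by blast
  have "reg_cond_distr M F Y (\<lambda>\<omega>. distr (K \<omega>) borel g)"
    unfolding reg_cond_distr_def
  proof (intro conjI ballI)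
    show "(\<lambda>\<omega>. distr (K \<omega>) borel g) \<in> measurable F (prob_algebra borel)"
      using K(1) by (rule measurable_compose[OF _ measurable_distr_prob_space[OF g]])
    fix A :: "'x set" assume A: "A \<in> sets borel"
    have "g -` A \<in> sets borel" using measurable_sets[OF g A] by simp
    from K(2)[OF this] AE_space
    show "AE \<omega> in M. measure (distr (K \<omega>) borel g) A = real_cond_exp M F (\<lambda>\<omega>. indicator A (Y \<omega>)) \<omega>"
    proof eventually_elim
      case (elim \<omega>)
      have "\<omega> \<in> space F" using elim sub by (auto simp: subalgebra_def)
      then have s: "sets (K \<omega>) = sets borel"
        using measurable_space[OF K(1)] by (simp add: space_prob_algebra)
      then have "measure (distr (K \<omega>) borel g) A = measure (K \<omega>) (g -` A)"
        using A g sets_eq_imp_space_eq[OF s]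
        by (subst measure_distr) (auto simp: measurable_cong_sets[OF s refl])
      moreover have "(\<lambda>\<omega>. indicator (g -` A) (h (Y \<omega>)) :: real) = (\<lambda>\<omega>. indicator A (Y \<omega>))"
        by (simp add: gh indicator_def fun_eq_iff)
      ultimately show ?case using elim by simp
    qed
  qed
  then show ?thesis by blast
qed

section \<open>Cylinder functions and mixtures of product measures\<close>

definition cylinder_prod :: "('m \<times> 'i) set \<Rightarrow> ('m \<times> 'i \<Rightarrow> 'x \<Rightarrow> real) \<Rightarrow> ('m \<Rightarrow> 'i \<Rightarrow> 'x) \<Rightarrow> real" where
  "cylinder_prod C f z = (\<Prod>c\<in>C. f c (z (fst c) (snd c)))"

text \<open>The range [0,1] is stable under products and lets the constant 1 dominate every
  integrand below.\<close>

definition unit_continuous :: "('x::topological_space \<Rightarrow> real) \<Rightarrow> bool" where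
  "unit_continuous f \<longleftrightarrow> continuous_on UNIV f \<and> (\<forall>x. 0 \<le> f x \<and> f x \<le> 1)"

definition cylinder_functions :: "(('m \<Rightarrow> 'i \<Rightarrow> 'x::topological_space) \<Rightarrow> real) set" where
  "cylinder_functions = {cylinder_prod C f | C f. finite C \<and> (\<forall>c. unit_continuous (f c))}"

lemma cylinder_functionsI:
  "finite C \<Longrightarrow> (\<And>c. unit_continuous (f c)) \<Longrightarrow> cylinder_prod C f \<in> cylinder_functions"
  unfolding cylinder_functions_def by blast

lemma unit_continuousD:
  assumes "unit_continuous f"
  shows "continuous_on UNIV f" "0 \<le> f x" "f x \<le> 1" "f \<in> borel_measurable borel"
  using assms by (auto simp: unit_continuous_def intro: borel_measurable_continuous_onI)

lemma unit_continuous_bounded: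
  assumes "unit_continuous f"
  shows "bounded (range f)"
proof (rule boundedI[of _ 1])
  fix y assume "y \<in> range f"
  then show "norm y \<le> 1" using unit_continuousD(2,3)[OF assms] by auto
qed

lemma unit_continuous_mult: "unit_continuous f \<Longrightarrow> unit_continuous g \<Longrightarrow> unit_continuous (\<lambda>x. f x * g x)"
  unfolding unit_continuous_def by (auto intro!: continuous_on_mult mult_le_one)

lemma unit_continuous_if: "unit_continuous f \<Longrightarrow> unit_continuous (\<lambda>x. if P then f x else 1)"
  by (cases P) (auto simp: unit_continuous_def)

lemma unit_continuous_integral_le_one:
  assumes f: "unit_continuous f" and N: "prob_space N" "sets N = sets borel"
  shows "integrable N f" "0 \<le> (\<integral>x. f x \<partial>N)" "(\<integral>x. f x \<partial>N) \<le> 1"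
proof -
  interpret prob_space N by fact
  show i: "integrable N f"
    using unit_continuousD[OF f] measurable_cong_sets[OF N(2) refl, of borel]
    by (intro integrable_const_bound[where B=1]) auto
  show "0 \<le> (\<integral>x. f x \<partial>N)" using unit_continuousD[OF f] by simp
  show "(\<integral>x. f x \<partial>N) \<le> 1" using i unit_continuousD[OF f] by (intro integral_le_const) auto
qed

lemma open_fun_contains_box:
  fixes U :: "('a \<Rightarrow> 'b::topological_space) set"
  assumes "open U" "x \<in> U"
  obtains I V where "finite I" "\<And>i. open (V i)" "\<And>i. x i \<in> V i" "{y. \<forall>i\<in>I. y i \<in> V i} \<subseteq> U"
proof -
  have "openin (product_topology (\<lambda>i. euclidean) UNIV) U"
    using assms unfolding open_fun_def by auto
  from product_topology_open_contains_basis[OF this assms(2)]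
  obtain X where X: "x \<in> (\<Pi>\<^sub>E i\<in>UNIV. X i)" "\<And>i. open (X i)" "finite {i. X i \<noteq> UNIV}" "(\<Pi>\<^sub>E i\<in>UNIV. X i) \<subseteq> U"
    by auto
  show thesis
  proof
    show "finite {i. X i \<noteq> UNIV}" "open (X i)" "x i \<in> X i" for i using X by auto
    show "{y. \<forall>i\<in>{i. X i \<noteq> UNIV}. y i \<in> X i} \<subseteq> U"
      using X(4) by (auto simp: PiE_def Pi_def extensional_def subset_iff)
  qed
qed

lemma continuous_on_coordinate2:
  "continuous_on UNIV (\<lambda>z :: 'm \<Rightarrow> 'i \<Rightarrow> 'x::topological_space. z m i)"
  by (rule continuous_on_product_then_coordinatewise[OF continuous_on_product_coordinates])

lemma cylinder_prod_measurable:
  fixes f :: "'m::countable \<times> 'i::countable \<Rightarrow> 'x::second_countable_topology \<Rightarrow> real"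
  assumes "\<And>c. unit_continuous (f c)"
  shows "cylinder_prod C f \<in> borel_measurable borel"
  unfolding cylinder_prod_def
proof (intro borel_measurable_prod)
  fix c :: "'m \<times> 'i"
  have "(\<lambda>z :: 'm \<Rightarrow> 'i \<Rightarrow> 'x. z (fst c) (snd c)) \<in> borel \<rightarrow>\<^sub>M borel"
    by (intro borel_measurable_continuous_onI continuous_on_coordinate2)
  then show "(\<lambda>z :: 'm \<Rightarrow> 'i \<Rightarrow> 'x. f c (z (fst c) (snd c))) \<in> borel_measurable borel"
    using unit_continuousD(4)[OF assms] by (rule measurable_compose)
qed

lemma cylinder_prod_bounds:
  assumes "\<And>c. unit_continuous (f c)"
  shows "0 \<le> cylinder_prod C f z" "cylinder_prod C f z \<le> 1"
  unfolding cylinder_prod_def using unit_continuousD[OF assms] by (auto intro!: prod_nonneg prod_le_1)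

text \<open>This function is 1 up to distance r/2 from x and 0 from distance r on.\<close>

lemma unit_continuous_bump:
  fixes x :: "'x::metric_space"
  assumes "r > 0"
  shows "unit_continuous (\<lambda>y. max 0 (min 1 (2 - 2 * dist y x / r)))"
  unfolding unit_continuous_def using assms by (auto intro!: continuous_intros)

text \<open>A neighbourhood in the iterated product topology restricts finitely many rows, and in
  each of them finitely many columns. The product of one bump per restricted cell is therefore a
  separating cylinder function.\<close>

lemma convergence_determining_cylinder_functions:
  "convergence_determining (cylinder_functions :: (('m::countable \<Rightarrow> 'i::countable \<Rightarrow> 'x::polish_space) \<Rightarrow> real) set)"
proof
  let ?P = "cylinder_functions :: (('m \<Rightarrow> 'i \<Rightarrow> 'x) \<Rightarrow> real) set"
  show "g \<in> borel_measurable borel" "0 \<le> g z" "g z \<le> 1" if "g \<in> ?P" for g z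
    using that cylinder_prod_measurable cylinder_prod_bounds unfolding cylinder_functions_def by blast+
  have "cylinder_prod {} (\<lambda>_ _. 1) \<in> ?P"
    by (rule cylinder_functionsI) (auto simp: unit_continuous_def)
  then show "(\<lambda>_. 1) \<in> ?P" by (simp add: cylinder_prod_def[abs_def])
  show "(\<lambda>z. g z * h z) \<in> ?P" if gh: "g \<in> ?P" "h \<in> ?P" for g h
  proof -
    obtain C f where g: "g = cylinder_prod C f" "finite C" "\<And>c. unit_continuous (f c)"
      using gh(1) unfolding cylinder_functions_def by blast
    obtain C' f' where h: "h = cylinder_prod C' f'" "finite C'" "\<And>c. unit_continuous (f' c)"
      using gh(2) unfolding cylinder_functions_def by blast
    \<comment> \<open>Padding with the constant 1 brings both products to the common cell
      set.\<close>
    let ?f = "\<lambda>c x. (if c \<in> C then f c x else 1) * (if c \<in> C' then f' c x else 1)"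
    have eq: "g z * h z = cylinder_prod (C \<union> C') ?f z" for z
    proof -
      have "(\<Prod>c\<in>C. f c (z (fst c) (snd c))) = (\<Prod>c\<in>C \<union> C'. if c \<in> C then f c (z (fst c) (snd c)) else 1)"
        using g(2) h(2) by (intro prod.mono_neutral_cong_left) auto
      moreover have "(\<Prod>c\<in>C'. f' c (z (fst c) (snd c))) = (\<Prod>c\<in>C \<union> C'. if c \<in> C' then f' c (z (fst c) (snd c)) else 1)"
        using g(2) h(2) by (intro prod.mono_neutral_cong_left) auto
      ultimately show ?thesis unfolding g(1) h(1) cylinder_prod_def prod.distrib by simp
    qed
    show ?thesis
      unfolding eq using g(2,3) h(2,3) by (intro cylinder_functionsI unit_continuous_mult unit_continuous_if) auto
  qed
  show "\<exists>g\<in>?P. \<exists>W. open W \<and> z \<in> W \<and> (\<forall>y\<in>W. g y = 1) \<and> (\<forall>y. y \<notin> U \<longrightarrow> g y = 0)"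
    if U: "open U" "z \<in> U" for U z
  proof -
    obtain I V where I: "finite I" "\<And>m. open (V m)" "\<And>m. z m \<in> V m" "{y. \<forall>m\<in>I. y m \<in> V m} \<subseteq> U"
      using open_fun_contains_box[OF U] by blast
    \<comment> \<open>The box lemma is applied a second time, now inside the open set of each
      row.\<close>
    have "\<forall>m. \<exists>J W. finite J \<and> (\<forall>i. open (W i) \<and> z m i \<in> W i) \<and> {y. \<forall>i\<in>J. y i \<in> W i} \<subseteq> V m"
    proof
      fix m
      show "\<exists>J W. finite J \<and> (\<forall>i. open (W i) \<and> z m i \<in> W i) \<and> {y. \<forall>i\<in>J. y i \<in> W i} \<subseteq> V m"
        by (rule open_fun_contains_box[OF I(2,3)[of m]]) blast
    qed
    from choice[OF this] obtain J where
      "\<forall>m. \<exists>W. finite (J m) \<and> (\<forall>i. open (W i) \<and> z m i \<in> W i) \<and> {y. \<forall>i\<in>J m. y i \<in> W i} \<subseteq> V m" ..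
    from choice[OF this] obtain W where J: "\<And>m. finite (J m)" "\<And>m i. open (W m i)" "\<And>m i. z m i \<in> W m i"
      "\<And>m. {y. \<forall>i\<in>J m. y i \<in> W m i} \<subseteq> V m"
      by blast
    have "\<exists>r>0. ball (z m i) r \<subseteq> W m i" for m i
      using J(2,3)[of m i] by (rule openE) blast
    then obtain r where r: "\<And>m i. r m i > 0" "\<And>m i. ball (z m i) (r m i) \<subseteq> W m i" by metis
    define f where "f c y = max 0 (min 1 (2 - 2 * dist y (z (fst c) (snd c)) / r (fst c) (snd c)))" for c y
    let ?C = "Sigma I J"
    let ?B = "\<Inter>c\<in>?C. {y. dist (y (fst c) (snd c)) (z (fst c) (snd c)) < r (fst c) (snd c) / 2}"
    have C: "finite ?C" using I(1) J(1) by auto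
    have "unit_continuous (f c)" for c
      unfolding f_def[abs_def] by (rule unit_continuous_bump[OF r(1)])
    then have "cylinder_prod ?C f \<in> ?P" by (rule cylinder_functionsI[OF C])
    moreover have "open ?B"
      using C by (intro open_INT ballI open_Collect_less continuous_intros continuous_on_coordinate2)
    moreover have "z \<in> ?B" using r(1) by simp
    moreover have "cylinder_prod ?C f y = 1" if "y \<in> ?B" for y
      unfolding cylinder_prod_def
    proof (rule prod.neutral, rule ballI)
      fix c assume "c \<in> ?C"
      then have "dist (y (fst c) (snd c)) (z (fst c) (snd c)) < r (fst c) (snd c) / 2" using that by blast
      then show "f c (y (fst c) (snd c)) = 1" using r(1)[of "fst c" "snd c"] by (simp add: f_def field_simps)
    qed
    moreover have "cylinder_prod ?C f y = 0" if yU: "y \<notin> U" for y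
    proof -
      \<comment> \<open>Leaving \<open>U\<close> means leaving the box of some cell, and the bump of
        that cell makes the product zero.\<close>
      from I(4) yU obtain m where m: "m \<in> I" "y m \<notin> V m" by blast
      with J(4)[of m] obtain i where i: "i \<in> J m" "y m i \<notin> W m i" by blast
      then have "y m i \<notin> ball (z m i) (r m i)" using r(2)[of m i] by blast
      then have "r m i \<le> dist (y m i) (z m i)" by (simp add: dist_commute)
      then have "f (m, i) (y m i) = 0" using r(1)[of m i] by (simp add: f_def field_simps)
      then show ?thesis
        unfolding cylinder_prod_def using C m i by (intro prod_zero) auto
    qed
    ultimately show ?thesis by blast
  qed
qed

section \<open>Kernels and integrals on infinite products\<close>

lemma measurable_PiM_prob_kernel:
  assumes K: "\<And>i. i \<in> I \<Longrightarrow> K i \<in> measurable M (prob_algebra (N i))"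
  shows "(\<lambda>\<omega>. PiM I (\<lambda>i. K i \<omega>)) \<in> measurable M (prob_algebra (PiM I N))"
proof (rule measurable_prob_algebra_generated[OF sets_PiM Int_stable_prod_algebra prod_algebra_sets_into_space])
  have Kp: "prob_space (K i \<omega>)" "sets (K i \<omega>) = sets (N i)" if "i \<in> I" "\<omega> \<in> space M" for i \<omega>
    using measurable_space[OF K[OF that(1)] that(2)] by (auto simp: space_prob_algebra)
  fix \<omega> assume \<omega>: "\<omega> \<in> space M"
  show "prob_space (PiM I (\<lambda>i. K i \<omega>))" using Kp \<omega> by (intro prob_space_PiM)
  show "sets (PiM I (\<lambda>i. K i \<omega>)) = sets (PiM I N)" using Kp \<omega> by (intro sets_PiM_cong) auto
next
  have Kp: "prob_space (K i \<omega>)" "sets (K i \<omega>) = sets (N i)" if "i \<in> I" "\<omega> \<in> space M" for i \<omega>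
    using measurable_space[OF K[OF that(1)] that(2)] by (auto simp: space_prob_algebra)
  fix A assume "A \<in> prod_algebra I N"
  then obtain J E where A: "A = prod_emb I N J (\<Pi>\<^sub>E j\<in>J. E j)" "finite J" "J \<subseteq> I"
    "\<And>i. i \<in> J \<Longrightarrow> E i \<in> sets (N i)"
    by (auto elim!: prod_algebraE)
  have eq: "emeasure (PiM I (\<lambda>i. K i \<omega>)) A = (\<Prod>i\<in>J. emeasure (K i \<omega>) (E i))" if \<omega>: "\<omega> \<in> space M" for \<omega>
  proof -
    \<comment> \<open>\<open>emeasure_PiM_emb\<close> expects the cylinder to be built over the
      spaces of the measures \<open>K i \<omega>\<close>, which coincide with those of
      \<open>N i\<close>.\<close>
    have "A = prod_emb I (\<lambda>i. K i \<omega>) J (\<Pi>\<^sub>E j\<in>J. E j)"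
      unfolding A(1) prod_emb_def using sets_eq_imp_space_eq[OF Kp(2)[OF _ \<omega>]] by (auto cong: PiE_cong)
    then show ?thesis
      using A Kp \<omega> by (auto intro!: emeasure_PiM_emb)
  qed
  have "(\<lambda>\<omega>. \<Prod>i\<in>J. emeasure (K i \<omega>) (E i)) \<in> borel_measurable M"
    using A(3,4) K by (intro borel_measurable_prod_ennreal measurable_emeasure_kernel[where N="N _"] measurable_prob_algebraD) auto
  then show "(\<lambda>\<omega>. emeasure (PiM I (\<lambda>i. K i \<omega>)) A) \<in> borel_measurable M"
    by (rule measurable_cong[THEN iffD1, rotated]) (simp add: eq)
qed

text \<open>The integrand sees only the coordinates in \<open>J\<close>, so it can be integrated
  under the marginal on \<open>J\<close>, a finite product measure.\<close>

lemma integral_PiM_finite_prod: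
  fixes f :: "'i \<Rightarrow> 'a \<Rightarrow> real"
  assumes N: "\<And>i. prob_space (N i)" and J: "finite J" "J \<subseteq> I"
    and f: "\<And>i. i \<in> J \<Longrightarrow> integrable (N i) (f i)"
  shows "(\<integral>x. (\<Prod>i\<in>J. f i (x i)) \<partial>PiM I N) = (\<Prod>i\<in>J. \<integral>x. f i x \<partial>N i)"
proof -
  interpret product_prob_space N I
    by (simp add: product_prob_space_def product_prob_space_axioms_def product_sigma_finite_def N prob_space_imp_sigma_finite)
  have [measurable]: "(\<lambda>x. \<Prod>i\<in>J. f i (x i)) \<in> borel_measurable (PiM J N)"
    using f by (intro borel_measurable_prod measurable_compose[OF measurable_component_singleton borel_measurable_integrable]) auto
  have "(\<integral>x. (\<Prod>i\<in>J. f i (x i)) \<partial>PiM I N) = (\<integral>x. (\<Prod>i\<in>J. f i (restrict x J i)) \<partial>PiM I N)"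
    by (intro Bochner_Integration.integral_cong prod.cong) auto
  also have "\<dots> = (\<integral>x. (\<Prod>i\<in>J. f i (x i)) \<partial>distr (PiM I N) (PiM J N) (\<lambda>x. restrict x J))"
    using J by (intro integral_distr[symmetric] measurable_restrict_subset) auto
  also have "\<dots> = (\<Prod>i\<in>J. \<integral>x. f i x \<partial>N i)"
    unfolding distr_PiM_restrict_finite[OF J] by (rule product_integral_prod[OF J(1) f])
  finally show ?thesis .
qed

text \<open>Grouping the cells by rows turns the integral into two nested finite products: over the
  independent rows, then over the columns within each.\<close>

lemma integral_PiM_PiM_cylinder_prod:
  fixes N :: "'i \<Rightarrow> 'x::topological_space measure"
  assumes N: "\<And>i. prob_space (N i)" "\<And>i. sets (N i) = sets borel"
    and C: "finite C" and f: "\<And>c. unit_continuous (f c)"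
  shows "(\<integral>z. cylinder_prod C f z \<partial>PiM UNIV (\<lambda>m::'m. PiM UNIV N)) = (\<Prod>c\<in>C. \<integral>x. f c x \<partial>N (snd c))"
proof -
  let ?D = "\<lambda>m. {i. (m, i) \<in> C}"
  have S: "C = Sigma (fst ` C) ?D" by force
  have D: "finite (?D m)" for m
    by (rule finite_subset[OF _ finite_imageI[OF C, of snd]]) force
  have split: "(\<Prod>c\<in>C. h c) = (\<Prod>m\<in>fst ` C. \<Prod>i\<in>?D m. h (m, i))" for h :: "'m \<times> 'i \<Rightarrow> real"
    using prod.Sigma[of "fst ` C" ?D "\<lambda>m i. h (m, i)"] C D S by (simp add: split_def)
  have P: "prob_space (PiM UNIV N)" using N by (intro prob_space_PiM)
  have fm: "f c \<in> borel_measurable (N i)" for c i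
    using unit_continuousD(4)[OF f] by (simp add: measurable_cong_sets[OF N(2) refl])
  have int: "integrable (N i) (f c)" for c i
    by (intro unit_continuous_integral_le_one f N)
  have "integrable (PiM UNIV N) (\<lambda>y. \<Prod>i\<in>?D m. f (m, i) (y i))" for m
  proof -
    interpret prob_space "PiM UNIV N" by (rule P)
    show ?thesis
    proof (rule integrable_const_bound[where B=1])
      show "AE y in PiM UNIV N. norm (\<Prod>i\<in>?D m. f (m, i) (y i)) \<le> 1"
        using unit_continuousD[OF f] by (intro AE_I2) (auto simp: abs_prod intro!: prod_le_1)
      show "(\<lambda>y. \<Prod>i\<in>?D m. f (m, i) (y i)) \<in> borel_measurable (PiM UNIV N)"
        using fm by (intro borel_measurable_prod measurable_compose[OF measurable_component_singleton]) auto
    qed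
  qed
  then have "(\<integral>z. (\<Prod>m\<in>fst ` C. \<Prod>i\<in>?D m. f (m, i) (z m i)) \<partial>PiM UNIV (\<lambda>m::'m. PiM UNIV N)) =
      (\<Prod>m\<in>fst ` C. \<integral>y. (\<Prod>i\<in>?D m. f (m, i) (y i)) \<partial>PiM UNIV N)"
    using C P by (intro integral_PiM_finite_prod) auto
  also have "\<dots> = (\<Prod>m\<in>fst ` C. \<Prod>i\<in>?D m. \<integral>x. f (m, i) x \<partial>N i)"
    using D int N by (intro prod.cong refl integral_PiM_finite_prod) auto
  finally show ?thesis unfolding cylinder_prod_def split by simp
qed

lemma sets_PiM_PiM_borel:
  fixes N :: "'m::countable \<Rightarrow> 'i::countable \<Rightarrow> 'x::second_countable_topology measure"
  assumes "\<And>m i. sets (N m i) = sets borel"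
  shows "sets (PiM UNIV (\<lambda>m. PiM UNIV (N m))) = sets borel"
proof -
  have "sets (PiM UNIV (N m)) = sets borel" for m
    using sets_PiM_cong[OF refl, of UNIV "N m" "\<lambda>_. borel"] assms sets_PiM_equal_borel by metis
  then show ?thesis
    using sets_PiM_cong[OF refl, of UNIV "\<lambda>m. PiM UNIV (N m)" "\<lambda>_. borel"] sets_PiM_equal_borel by metis
qed

section \<open>The mixture law and its symmetry\<close>

locale random_measures = prob_space M for M :: "'w measure" +
  fixes \<alpha> :: "'i::countable \<Rightarrow> 'w \<Rightarrow> 'x::polish_space measure"
  assumes \<alpha>_measurable: "\<And>i. \<alpha> i \<in> measurable M (prob_algebra borel)"
begin

lemma \<alpha>_prob: "\<omega> \<in> space M \<Longrightarrow> prob_space (\<alpha> i \<omega>)" "\<omega> \<in> space M \<Longrightarrow> sets (\<alpha> i \<omega>) = sets borel"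
  using measurable_space[OF \<alpha>_measurable] by (auto simp: space_prob_algebra)

lemma measurable_mixture_kernel:
  "(\<lambda>\<omega>. PiM UNIV (\<lambda>m::nat. PiM UNIV (\<lambda>i. \<alpha> i \<omega>))) \<in> measurable M (prob_algebra borel)"
proof -
  have "(\<lambda>\<omega>. PiM UNIV (\<lambda>m::nat. PiM UNIV (\<lambda>i. \<alpha> i \<omega>))) \<in>
      measurable M (prob_algebra (PiM UNIV (\<lambda>m::nat. PiM UNIV (\<lambda>i::'i. borel :: 'x measure))))"
    by (intro measurable_PiM_prob_kernel \<alpha>_measurable)
  moreover have "prob_algebra (PiM UNIV (\<lambda>m::nat. PiM UNIV (\<lambda>i::'i. borel :: 'x measure))) = prob_algebra borel"
    unfolding prob_algebra_def by (intro arg_cong2[where f=restrict_space] refl subprob_algebra_cong sets_PiM_PiM_borel)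
  ultimately show ?thesis by simp
qed

lemma sets_mixture_law: "sets (mixture_law M \<alpha>) = sets borel"
  unfolding mixture_law_def using not_empty
  by (intro sets_bind_measurable[OF measurable_prob_algebraD[OF measurable_mixture_kernel]])

lemma prob_space_mixture_law: "prob_space (mixture_law M \<alpha>)"
  unfolding mixture_law_def
  by (rule prob_space_bind'[OF _ measurable_mixture_kernel]) (simp add: space_prob_algebra prob_space_axioms)

lemma integral_mixture_law_cylinder_prod:
  assumes C: "finite C" and f: "\<And>c. unit_continuous (f c)"
  shows "(\<integral>z. cylinder_prod C f z \<partial>mixture_law M \<alpha>) = (\<integral>\<omega>. (\<Prod>c\<in>C. \<integral>x. f c x \<partial>\<alpha> (snd c) \<omega>) \<partial>M)"
proof -
  have "(\<integral>z. cylinder_prod C f z \<partial>mixture_law M \<alpha>) =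
      (\<integral>\<omega>. \<integral>z. cylinder_prod C f z \<partial>PiM UNIV (\<lambda>m::nat. PiM UNIV (\<lambda>i. \<alpha> i \<omega>)) \<partial>M)"
    unfolding mixture_law_def
  proof (rule integral_bind[where K=borel and B=1 and B'=1])
    show "cylinder_prod C f \<in> borel_measurable borel" using f by (rule cylinder_prod_measurable)
    show "\<bar>cylinder_prod C f z\<bar> \<le> 1" for z using cylinder_prod_bounds[of f C z, OF f] by simp
    show "finite_measure M" by unfold_locales
    show "AE \<omega> in M. emeasure (PiM UNIV (\<lambda>m::nat. PiM UNIV (\<lambda>i. \<alpha> i \<omega>)))
        (space (PiM UNIV (\<lambda>m::nat. PiM UNIV (\<lambda>i. \<alpha> i \<omega>)))) \<le> ennreal 1"
      using measurable_space[OF measurable_mixture_kernel]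
      by (intro AE_I2) (simp add: space_prob_algebra prob_space.emeasure_space_1)
  qed (rule measurable_prob_algebraD[OF measurable_mixture_kernel])
  also have "\<dots> = (\<integral>\<omega>. (\<Prod>c\<in>C. \<integral>x. f c x \<partial>\<alpha> (snd c) \<omega>) \<partial>M)"
    by (intro Bochner_Integration.integral_cong refl integral_PiM_PiM_cylinder_prod \<alpha>_prob C f)
  finally show ?thesis .
qed

text \<open>Under the mixture a factor at cell c is integrated against \<alpha> of its column alone,
  and a permutation within columns never changes the column of a cell.\<close>

lemma partially_exchangeable_mixture_law: "partially_exchangeable_law (mixture_law M \<alpha>)"
  unfolding partially_exchangeable_law_def
proof (intro allI impI)
  fix \<pi> :: "'i \<Rightarrow> nat \<Rightarrow> nat" assume \<pi>: "\<forall>i. \<exists>F. finite F \<and> \<pi> i permutes F"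
  let ?L = "mixture_law M \<alpha>"
  let ?T = "\<lambda>(z :: nat \<Rightarrow> 'i \<Rightarrow> 'x) m i. z (\<pi> i m) i"
  \<comment> \<open>\<sigma> c is the cell of the original array that the permuted array shows at
    c.\<close>
  define \<sigma> where "\<sigma> c = (\<pi> (snd c) (fst c), snd c)" for c
  have "inj (\<pi> i)" for i using \<pi> permutes_inj by blast
  then have \<sigma>: "inj \<sigma>" by (auto simp: inj_def \<sigma>_def)
  interpret L: prob_space ?L by (rule prob_space_mixture_law)
  interpret cd: convergence_determining "cylinder_functions :: ((nat \<Rightarrow> 'i \<Rightarrow> 'x) \<Rightarrow> real) set"
    by (rule convergence_determining_cylinder_functions)
  have "continuous_on UNIV ?T"
    by (intro continuous_on_coordinatewise_then_product continuous_on_coordinate2)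
  then have "?T \<in> borel \<rightarrow>\<^sub>M borel" by (rule borel_measurable_continuous_onI)
  then have T: "?T \<in> ?L \<rightarrow>\<^sub>M ?L" by (simp add: measurable_cong_sets[OF sets_mixture_law sets_mixture_law])
  show "distr ?L ?L ?T = ?L"
  proof (rule cd.measure_eqI)
    show "prob_space (distr ?L ?L ?T)" by (rule L.prob_space_distr[OF T])
    fix g :: "(nat \<Rightarrow> 'i \<Rightarrow> 'x) \<Rightarrow> real" assume "g \<in> cylinder_functions"
    then obtain C f where g: "g = cylinder_prod C f" "finite C" "\<And>c. unit_continuous (f c)"
      unfolding cylinder_functions_def by blast
    have gm: "g \<in> borel_measurable ?L"
      unfolding g(1) using cylinder_prod_measurable[OF g(3)] by (simp add: measurable_cong_sets[OF sets_mixture_law refl])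
    \<comment> \<open>Composing with the permutation gives again a cylinder function;
      \<open>inv \<sigma>\<close> recovers the factor that belongs to a moved cell.\<close>
    have "g (?T z) = cylinder_prod (\<sigma> ` C) (\<lambda>c. f (inv \<sigma> c)) z" for z
      unfolding g(1) cylinder_prod_def prod.reindex[OF inj_on_subset[OF \<sigma> subset_UNIV]]
      by (simp add: inv_f_f[OF \<sigma>]) (simp add: \<sigma>_def)
    then have "(\<integral>z. g z \<partial>distr ?L ?L ?T) = (\<integral>z. cylinder_prod (\<sigma> ` C) (\<lambda>c. f (inv \<sigma> c)) z \<partial>?L)"
      using integral_distr[OF T gm] by simp
    also have "\<dots> = (\<integral>\<omega>. (\<Prod>c\<in>\<sigma> ` C. \<integral>x. f (inv \<sigma> c) x \<partial>\<alpha> (snd c) \<omega>) \<partial>M)"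
      using g by (intro integral_mixture_law_cylinder_prod) auto
    also have "\<dots> = (\<integral>\<omega>. (\<Prod>c\<in>C. \<integral>x. f c x \<partial>\<alpha> (snd c) \<omega>) \<partial>M)"
      unfolding prod.reindex[OF inj_on_subset[OF \<sigma> subset_UNIV]]
      by (simp add: inv_f_f[OF \<sigma>]) (simp add: \<sigma>_def)
    also have "\<dots> = (\<integral>z. g z \<partial>?L)"
      unfolding g(1) using g by (intro integral_mixture_law_cylinder_prod[symmetric]) auto
    finally show "(\<integral>z. g z \<partial>distr ?L ?L ?T) = (\<integral>z. g z \<partial>?L)" .
  qed (auto simp: sets_mixture_law prob_space_mixture_law)
qed

end

section \<open>Partially c.i.d. processes\<close>

locale partially_cid_process = random_measures M \<alpha>
  for M :: "'w measure" and \<alpha> :: "'i::countable \<Rightarrow> 'w \<Rightarrow> 'x::polish_space measure" +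
  fixes G :: "nat \<Rightarrow> 'w measure" and X :: "nat \<Rightarrow> 'i \<Rightarrow> 'w \<Rightarrow> 'x"
  assumes filtration: "filtration_on M G"
    and cid: "partially_cid M G X"
    and directing: "directing_measures M G X \<alpha>"
begin

section \<open>The sigma-algebras that omit one cell of a row\<close>

lemma subalgebra_G: "subalgebra M (G n)"
  using filtration by (simp add: filtration_on_def subalgebra_def)

lemma subalgebra_G_mono:
  assumes "n \<le> m"
  shows "subalgebra (G m) (G n)"
proof -
  have "sets (G n) \<subseteq> sets (G m)"
    by (rule lift_Suc_mono_le[OF _ assms]) (use filtration in \<open>simp add: filtration_on_def\<close>)
  then show ?thesis using filtration by (simp add: filtration_on_def subalgebra_def)
qed

lemma measurable_X_G: "n \<ge> 1 \<Longrightarrow> X n i \<in> borel_measurable (G n)"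
  using cid by (simp add: partially_cid_def)

lemma measurable_X: "n \<ge> 1 \<Longrightarrow> X n i \<in> borel_measurable M"
  using measurable_from_subalg[OF subalgebra_G measurable_X_G] .

lemma Gj_generator_subset:
  "sets (G n) \<union> (\<Union>i\<in>{i. i \<noteq> j}. {X (Suc n) i -` A \<inter> space M | A. A \<in> sets borel}) \<subseteq> sets (G (Suc n))"
proof -
  have "space (G (Suc n)) = space M" using filtration by (simp add: filtration_on_def)
  then have "X (Suc n) i -` A \<inter> space M \<in> sets (G (Suc n))" if "A \<in> sets borel" for i A
    using measurable_sets[OF measurable_X_G[of "Suc n" i] that] by simp
  then show ?thesis
    using subalgebra_G_mono[of n "Suc n"] by (auto simp: subalgebra_def)
qed

lemma Gj_generator_Pow:
  "sets (G n) \<union> (\<Union>i\<in>{i. i \<noteq> j}. {X (Suc n) i -` A \<inter> space M | A. A \<in> sets borel}) \<subseteq> Pow (space M)"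
  using Gj_generator_subset[of n j] subalgebra_G[of "Suc n"] sets.sets_into_space
  unfolding subalgebra_def by blast

lemma space_Gj [simp]: "space (Gj M G X n j) = space M"
  unfolding Gj_def using Gj_generator_Pow by (rule space_measure_of)

lemma sets_Gj: "sets (Gj M G X n j) = sigma_sets (space M)
    (sets (G n) \<union> (\<Union>i\<in>{i. i \<noteq> j}. {X (Suc n) i -` A \<inter> space M | A. A \<in> sets borel}))"
  unfolding Gj_def using Gj_generator_Pow by (rule sets_measure_of)

text \<open>Weights measurable for \<open>Gj\<close> at time n are thereby admissible for every
  predictive kernel from time n+1 on.\<close>

lemma subalgebra_G_Suc_Gj: "subalgebra (G (Suc n)) (Gj M G X n j)"
proof -
  have s: "space (G (Suc n)) = space M" using filtration by (simp add: filtration_on_def)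
  have "sets (Gj M G X n j) \<subseteq> sets (G (Suc n))"
    unfolding sets_Gj s[symmetric] using Gj_generator_subset[of n j] s by (intro sets.sigma_sets_subset) simp
  then show ?thesis by (simp add: subalgebra_def s)
qed

lemma subalgebra_Gj_G: "subalgebra (Gj M G X n j) (G n)"
  using filtration by (auto simp: subalgebra_def sets_Gj filtration_on_def)

lemma subalgebra_Gj: "subalgebra M (Gj M G X n j)"
  using subalgebra_G_Suc_Gj[of n j] subalgebra_G[of "Suc n"] by (auto simp: subalgebra_def)

text \<open>This is what permits removing the cells of one row one after the other.\<close>

lemma measurable_X_Gj:
  assumes "i \<noteq> j"
  shows "X (Suc n) i \<in> borel_measurable (Gj M G X n j)"
proof (rule measurableI)
  fix A :: "'x set" assume "A \<in> sets borel"
  then show "X (Suc n) i -` A \<inter> space (Gj M G X n j) \<in> sets (Gj M G X n j)"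
    unfolding space_Gj sets_Gj using assms by (intro sigma_sets.Basic) blast
qed simp

text \<open>One version is fixed per time and column, because the convergence in
  \<open>directing_measures\<close> concerns a whole sequence of kernels, with a null set depending
  on that sequence.\<close>

definition predictive :: "nat \<Rightarrow> 'i \<Rightarrow> 'w \<Rightarrow> 'x measure" where
  "predictive n i = (SOME K. reg_cond_distr M (G n) (X (Suc n) i) K)"

lemma reg_cond_distr_predictive: "reg_cond_distr M (G n) (X (Suc n) i) (predictive n i)"
  unfolding predictive_def
  by (rule someI_ex[OF reg_cond_distr_exists[OF subalgebra_G measurable_X]]) simp

lemma measurable_predictive: "predictive n i \<in> measurable (G n) (prob_algebra borel)"
  using reg_cond_distr_predictive[of n i] by (simp add: reg_cond_distr_def)

lemma predictive_prob:
  assumes "\<omega> \<in> space M"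
  shows "prob_space (predictive n i \<omega>)" "sets (predictive n i \<omega>) = sets borel"
  using measurable_space[OF measurable_from_subalg[OF subalgebra_G measurable_predictive] assms]
  by (auto simp: space_prob_algebra)

lemma AE_predictive_tendsto:
  assumes f: "unit_continuous f"
  shows "AE \<omega> in M. (\<lambda>n. \<integral>x. f x \<partial>predictive n i \<omega>) \<longlonglongrightarrow> (\<integral>x. f x \<partial>\<alpha> i \<omega>)"
proof -
  have "(\<forall>n. reg_cond_distr M (G n) (X (Suc n) i) (K n)) \<longrightarrow>
      (AE \<omega> in M. weak_conv_top (\<lambda>n. K n \<omega>) (\<alpha> i \<omega>))" for K
    using directing unfolding directing_measures_def by blast
  from this[of "\<lambda>n. predictive n i"]
  have "AE \<omega> in M. weak_conv_top (\<lambda>n. predictive n i \<omega>) (\<alpha> i \<omega>)"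
    by (simp add: reg_cond_distr_predictive)
  then show ?thesis
  proof eventually_elim
    case (elim \<omega>)
    show ?case
      using elim unit_continuousD(1)[OF f] unit_continuous_bounded[OF f] unfolding weak_conv_top_def by blast
  qed
qed

lemma measurable_integral_kernel:
  assumes f: "unit_continuous f" and K: "K \<in> measurable N (prob_algebra borel)"
  shows "(\<lambda>\<omega>. \<integral>x. f x \<partial>K \<omega>) \<in> borel_measurable N"
proof -
  note [measurable] = unit_continuousD(4)[OF f] measurable_prob_algebraD[OF K]
  show ?thesis by measurable
qed

text \<open>By the c.i.d. property \<open>X (n + 1) j\<close> may be replaced by \<open>X (n + k + 2) j\<close>, whose row lies beyond the
information in \<open>H\<close>; then let \<open>k\<close> tend to infinity.\<close>
lemma integral_directing:
  assumes f: "unit_continuous f" and H: "H \<in> borel_measurable (Gj M G X n j)" "\<And>\<omega>. 0 \<le> H \<omega>" "\<And>\<omega>. H \<omega> \<le> (1::real)"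
  shows "(\<integral>\<omega>. H \<omega> * f (X (Suc n) j \<omega>) \<partial>M) = (\<integral>\<omega>. H \<omega> * (\<integral>x. f x \<partial>\<alpha> j \<omega>) \<partial>M)"
proof -
  interpret Gj: finite_measure_subalgebra M "Gj M G X n j" by standard (rule subalgebra_Gj)
  have HM: "H \<in> borel_measurable M" by (rule measurable_from_subalg[OF subalgebra_Gj H(1)])
  have fX: "(\<lambda>\<omega>. f (X k j \<omega>)) \<in> borel_measurable M" if "k \<ge> 1" for k
    using measurable_X[OF that] unit_continuousD(4)[OF f] by (rule measurable_compose)
  have ce: "AE \<omega> in M. real_cond_exp M (Gj M G X n j) (\<lambda>\<omega>. f (X (n + 1) j \<omega>)) \<omega>
      = real_cond_exp M (Gj M G X n j) (\<lambda>\<omega>. f (X (n + k) j \<omega>)) \<omega>" if "k \<ge> 1" for k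
    using cid that unit_continuousD(4)[OF f] unit_continuous_bounded[OF f] unfolding partially_cid_def by blast
  \<comment> \<open>The kernel at time n+k+1 predicts row n+k+2, hence the shift by k+2 in the
    c.i.d. identity; time n+k+1 is late enough for \<open>H\<close> to be measurable even when k =
    0.\<close>
  have const: "(\<integral>\<omega>. H \<omega> * f (X (Suc n) j \<omega>) \<partial>M) = (\<integral>\<omega>. H \<omega> * (\<integral>x. f x \<partial>predictive (n + k + 1) j \<omega>) \<partial>M)" for k
  proof -
    have int: "integrable M (\<lambda>\<omega>. H \<omega> * f (X l j \<omega>))" if "l \<ge> 1" for l
      using HM fX[OF that] H unit_continuousD[OF f]
      by (intro integrable_const_bound[where B=1]) (auto simp: abs_mult intro!: mult_le_one)
    have "(\<integral>\<omega>. H \<omega> * f (X (Suc n) j \<omega>) \<partial>M) =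
        (\<integral>\<omega>. H \<omega> * real_cond_exp M (Gj M G X n j) (\<lambda>\<omega>. f (X (n + 1) j \<omega>)) \<omega> \<partial>M)"
      using int H fX by (subst Gj.real_cond_exp_intg(2)) auto
    also have "\<dots> = (\<integral>\<omega>. H \<omega> * real_cond_exp M (Gj M G X n j) (\<lambda>\<omega>. f (X (n + (k + 2)) j \<omega>)) \<omega> \<partial>M)"
    proof (rule integral_cong_AE)
      show "AE \<omega> in M. H \<omega> * real_cond_exp M (Gj M G X n j) (\<lambda>\<omega>. f (X (n + 1) j \<omega>)) \<omega>
          = H \<omega> * real_cond_exp M (Gj M G X n j) (\<lambda>\<omega>. f (X (n + (k + 2)) j \<omega>)) \<omega>"
        by (rule AE_mp[OF ce[of "k + 2"]]) auto
    qed (use HM in auto)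
    also have "\<dots> = (\<integral>\<omega>. H \<omega> * f (X (Suc (n + k + 1)) j \<omega>) \<partial>M)"
      using int H fX by (subst Gj.real_cond_exp_intg(2)) auto
    also have "\<dots> = (\<integral>\<omega>. H \<omega> * (\<integral>x. f x \<partial>predictive (n + k + 1) j \<omega>) \<partial>M)"
    proof -
      interpret Gn: finite_measure_subalgebra M "G (n + k + 1)" by standard (rule subalgebra_G)
      have "H \<in> borel_measurable (G (Suc n))" by (rule measurable_from_subalg[OF subalgebra_G_Suc_Gj H(1)])
      then have "H \<in> borel_measurable (G (n + k + 1))"
        by (rule measurable_from_subalg[OF subalgebra_G_mono, rotated]) simp
      then show ?thesis
        using H(2,3) unit_continuousD(2,3,4)[OF f] not_empty
        by (intro Gn.reg_cond_distr_integral reg_cond_distr_predictive measurable_X) auto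
    qed
    finally show ?thesis .
  qed
  have "(\<lambda>k. \<integral>\<omega>. H \<omega> * (\<integral>x. f x \<partial>predictive (n + k + 1) j \<omega>) \<partial>M) \<longlonglongrightarrow> (\<integral>\<omega>. H \<omega> * (\<integral>x. f x \<partial>\<alpha> j \<omega>) \<partial>M)"
  proof (rule integral_dominated_convergence[where w="\<lambda>_. 1"])
    show "(\<lambda>\<omega>. H \<omega> * (\<integral>x. f x \<partial>\<alpha> j \<omega>)) \<in> borel_measurable M"
      using HM measurable_integral_kernel[OF f \<alpha>_measurable] by (rule borel_measurable_times)
    show "(\<lambda>\<omega>. H \<omega> * (\<integral>x. f x \<partial>predictive (n + k + 1) j \<omega>)) \<in> borel_measurable M" for k
      using HM measurable_integral_kernel[OF f measurable_from_subalg[OF subalgebra_G measurable_predictive]]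
      by (rule borel_measurable_times)
    show "AE \<omega> in M. (\<lambda>k. H \<omega> * (\<integral>x. f x \<partial>predictive (n + k + 1) j \<omega>)) \<longlonglongrightarrow> H \<omega> * (\<integral>x. f x \<partial>\<alpha> j \<omega>)"
      using AE_predictive_tendsto[OF f, of j]
    proof eventually_elim
      case (elim \<omega>)
      from LIMSEQ_ignore_initial_segment[OF elim, of "n + 1"] show ?case
        by (intro tendsto_mult tendsto_const) (simp add: ac_simps)
    qed
    show "AE \<omega> in M. norm (H \<omega> * (\<integral>x. f x \<partial>predictive (n + k + 1) j \<omega>)) \<le> 1" for k
      using H(2,3) unit_continuous_integral_le_one[OF f predictive_prob]
      by (intro AE_I2) (auto simp: abs_mult intro!: mult_le_one)
  qed simp
  \<comment> \<open>By \<open>const\<close> the sequence does not depend on k, so its limit is its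
    value.\<close>
  then have "(\<lambda>k. \<integral>\<omega>. H \<omega> * f (X (Suc n) j \<omega>) \<partial>M) \<longlonglongrightarrow> (\<integral>\<omega>. H \<omega> * (\<integral>x. f x \<partial>\<alpha> j \<omega>) \<partial>M)"
    by (simp only: const[symmetric])
  then show ?thesis by (simp add: LIMSEQ_const_iff)
qed

text \<open>Removing a cell in the last row of \<open>C\<close> leaves a factor that is measurable for the corresponding
\<open>Gj\<close>. The resulting \<open>\<alpha>\<close>-integral is only measurable for \<open>M\<close>, so it is traded for the predictive integral
at time \<open>n\<close>, which is absorbed into \<open>B n\<close>.\<close>
lemma tendsto_integral_shifted_cells:
  fixes f :: "nat \<times> 'i \<Rightarrow> 'x \<Rightarrow> real"
  assumes C: "finite C" and f: "\<And>c. unit_continuous (f c)"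
    and B: "\<And>n. B n \<in> borel_measurable (G n)" "\<And>n \<omega>. 0 \<le> B n \<omega>" "\<And>n \<omega>. B n \<omega> \<le> (1::real)"
    and b: "b \<in> borel_measurable M" "AE \<omega> in M. (\<lambda>n. B n \<omega>) \<longlonglongrightarrow> b \<omega>"
  shows "(\<lambda>n. \<integral>\<omega>. B n \<omega> * (\<Prod>c\<in>C. f c (X (Suc (n + fst c)) (snd c) \<omega>)) \<partial>M)
    \<longlonglongrightarrow> (\<integral>\<omega>. b \<omega> * (\<Prod>c\<in>C. \<integral>x. f c x \<partial>\<alpha> (snd c) \<omega>) \<partial>M)"
  using C B b
\<comment> \<open>Ranking by row makes the inserted cell one of maximal row. The weights
  \<open>B\<close> and \<open>b\<close> vary because each removed cell is multiplied into
  them.\<close>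
proof (induction C arbitrary: B b rule: finite_ranking_induct[where f=fst])
  case empty
  have "(\<lambda>n. \<integral>\<omega>. B n \<omega> \<partial>M) \<longlonglongrightarrow> (\<integral>\<omega>. b \<omega> \<partial>M)"
  proof (rule integral_dominated_convergence[where w="\<lambda>_. 1"])
    show "B n \<in> borel_measurable M" for n by (rule measurable_from_subalg[OF subalgebra_G empty(1)])
  qed (use empty in auto)
  then show ?case by simp
next
  case (insert c S)
  show ?case
  \<comment> \<open>The ranking rule does not exclude inserting a cell that is already
    present.\<close>
  proof (cases "c \<in> S")
    case True
    then show ?thesis using insert.IH[OF insert.prems] by (simp add: insert_absorb)
  next
    case False
    obtain m j where c: "c = (m, j)" by (cases c)
    define H where "H n \<omega> = B n \<omega> * (\<Prod>c\<in>S. f c (X (Suc (n + fst c)) (snd c) \<omega>))" for n \<omega>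
    \<comment> \<open>The predictive measures are known to be probability measures only on the space
      of \<open>M\<close>. The cap at 1 makes the bound on the new weight hold at every \<omega>,
      and it changes nothing on that space.\<close>
    define I where "I n \<omega> = min 1 (\<integral>x. f c x \<partial>predictive n j \<omega>)" for n \<omega>
    define a where "a \<omega> = (\<integral>x. f c x \<partial>\<alpha> j \<omega>)" for \<omega>
    have Gj: "(\<lambda>\<omega>. f c' (X (Suc (n + fst c')) (snd c') \<omega>)) \<in> borel_measurable (Gj M G X (n + m) j)"
      if "c' \<in> S" for c' n
    proof -
      have "X (Suc (n + fst c')) (snd c') \<in> borel_measurable (Gj M G X (n + m) j)"
      \<comment> \<open>Cells of the same row lie in other columns, hence in the generator of
        \<open>Gj\<close>; cells of earlier rows are already measurable for
        \<open>G (n + m)\<close>.\<close>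
      proof (cases "fst c' = m")
        case True
        then have "snd c' \<noteq> j" using that \<open>c \<notin> S\<close> c by (cases c') auto
        then show ?thesis using True by (simp add: measurable_X_Gj)
      next
        case False
        then have "Suc (n + fst c') \<le> n + m" using insert.hyps(2)[OF that] c by simp
        then show ?thesis
          by (intro measurable_from_subalg[OF subalgebra_Gj_G measurable_from_subalg[OF subalgebra_G_mono measurable_X_G]]) auto
      qed
      then show ?thesis using unit_continuousD(4)[OF f] by (rule measurable_compose)
    qed
    have BGj: "B n \<in> borel_measurable (Gj M G X (n + m) j)" for n
      by (rule measurable_from_subalg[OF subalgebra_Gj_G measurable_from_subalg[OF subalgebra_G_mono insert.prems(1)]]) simp
    have HGj: "H n \<in> borel_measurable (Gj M G X (n + m) j)" for n
      unfolding H_def[abs_def] by (intro borel_measurable_times BGj borel_measurable_prod Gj)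
    have H01: "0 \<le> H n \<omega>" "H n \<omega> \<le> 1" for n \<omega>
      unfolding H_def using insert.prems(2,3) unit_continuousD(2,3)[OF f]
      by (auto intro!: mult_nonneg_nonneg mult_le_one prod_nonneg prod_le_1)
    have HM[measurable]: "H n \<in> borel_measurable M" for n
      by (rule measurable_from_subalg[OF subalgebra_Gj HGj])
    have IG: "I n \<in> borel_measurable (G n)" for n
      unfolding I_def[abs_def] using measurable_integral_kernel[OF f measurable_predictive]
      by (intro borel_measurable_min borel_measurable_const)
    then have IM[measurable]: "I n \<in> borel_measurable M" for n
      by (rule measurable_from_subalg[OF subalgebra_G])
    have I01: "0 \<le> I n \<omega>" "I n \<omega> \<le> 1" for n \<omega>
      unfolding I_def using unit_continuousD(2)[OF f] by (auto intro!: Bochner_Integration.integral_nonneg)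
    have am[measurable]: "a \<in> borel_measurable M"
      unfolding a_def[abs_def] by (rule measurable_integral_kernel[OF f \<alpha>_measurable])
    have a01: "0 \<le> a \<omega>" "a \<omega> \<le> 1" if "\<omega> \<in> space M" for \<omega>
      unfolding a_def using unit_continuous_integral_le_one[OF f \<alpha>_prob[OF that]] by auto
    have Ia: "AE \<omega> in M. (\<lambda>n. I n \<omega>) \<longlonglongrightarrow> a \<omega>"
      using AE_predictive_tendsto[OF f[of c], of j] AE_space
    proof eventually_elim
      case (elim \<omega>)
      from tendsto_min[OF tendsto_const elim(1), of 1] show ?case
        using a01[OF elim(2)] by (simp add: I_def a_def min_absorb2)
    qed
    have err_bound: "norm (H n \<omega> * (a \<omega> - I n \<omega>)) \<le> 1" if "\<omega> \<in> space M" for n \<omega>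
    proof -
      have "\<bar>a \<omega> - I n \<omega>\<bar> \<le> 1" using a01[OF that] I01[of n \<omega>] by linarith
      then show ?thesis using H01[of n \<omega>] by (simp add: abs_mult mult_le_one)
    qed
    \<comment> \<open>After the exchange of \<open>a\<close> for \<open>I n\<close>, the first
      integral has the shape of the induction hypothesis with weight \<open>B n\<close> times
      \<open>I n\<close>.\<close>
    have step: "(\<integral>\<omega>. B n \<omega> * (\<Prod>c\<in>insert c S. f c (X (Suc (n + fst c)) (snd c) \<omega>)) \<partial>M) =
        (\<integral>\<omega>. (B n \<omega> * I n \<omega>) * (\<Prod>c\<in>S. f c (X (Suc (n + fst c)) (snd c) \<omega>)) \<partial>M)
        + (\<integral>\<omega>. H n \<omega> * (a \<omega> - I n \<omega>) \<partial>M)" for n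
    proof -
      have "(\<integral>\<omega>. B n \<omega> * (\<Prod>c\<in>insert c S. f c (X (Suc (n + fst c)) (snd c) \<omega>)) \<partial>M) =
          (\<integral>\<omega>. H n \<omega> * f c (X (Suc (n + m)) j \<omega>) \<partial>M)"
        using False insert.hyps(1) c by (simp add: H_def ac_simps)
      also have "\<dots> = (\<integral>\<omega>. H n \<omega> * a \<omega> \<partial>M)"
        unfolding a_def by (rule integral_directing[OF f HGj H01])
      also have "\<dots> = (\<integral>\<omega>. H n \<omega> * I n \<omega> + H n \<omega> * (a \<omega> - I n \<omega>) \<partial>M)"
        by (simp add: algebra_simps)
      also have "\<dots> = (\<integral>\<omega>. H n \<omega> * I n \<omega> \<partial>M) + (\<integral>\<omega>. H n \<omega> * (a \<omega> - I n \<omega>) \<partial>M)"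
      proof (rule Bochner_Integration.integral_add)
        show "integrable M (\<lambda>\<omega>. H n \<omega> * I n \<omega>)"
          using H01 I01 by (intro integrable_const_bound[where B=1]) (auto simp: abs_mult intro!: mult_le_one)
        show "integrable M (\<lambda>\<omega>. H n \<omega> * (a \<omega> - I n \<omega>))"
          using err_bound by (intro integrable_const_bound[where B=1] AE_I2) auto
      qed
      finally show ?thesis by (simp add: H_def ac_simps)
    qed
    have err: "(\<lambda>n. \<integral>\<omega>. H n \<omega> * (a \<omega> - I n \<omega>) \<partial>M) \<longlonglongrightarrow> (\<integral>\<omega>. 0 \<partial>M)"
    proof (rule integral_dominated_convergence[where w="\<lambda>_. 1"])
      show "AE \<omega> in M. (\<lambda>n. H n \<omega> * (a \<omega> - I n \<omega>)) \<longlonglongrightarrow> 0"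
        using Ia
      proof eventually_elim
        case (elim \<omega>)
        have "(\<lambda>n. a \<omega> - I n \<omega>) \<longlonglongrightarrow> 0" using tendsto_diff[OF tendsto_const elim, of "a \<omega>"] by simp
        then have "(\<lambda>n. \<bar>a \<omega> - I n \<omega>\<bar>) \<longlonglongrightarrow> 0" by (rule tendsto_rabs_zero)
        then show ?case
          \<comment> \<open>\<open>H n\<close> need not converge; it only has to be bounded by
            1.\<close>
          by (rule Lim_null_comparison[rotated])
             (use H01 in \<open>auto simp: abs_mult intro!: always_eventually mult_left_le_one_le\<close>)
      qed
      show "AE \<omega> in M. norm (H n \<omega> * (a \<omega> - I n \<omega>)) \<le> 1" for n
        by (intro AE_I2 err_bound)
    qed auto
    have "(\<lambda>n. \<integral>\<omega>. (B n \<omega> * I n \<omega>) * (\<Prod>c\<in>S. f c (X (Suc (n + fst c)) (snd c) \<omega>)) \<partial>M)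
        \<longlonglongrightarrow> (\<integral>\<omega>. (b \<omega> * a \<omega>) * (\<Prod>c\<in>S. \<integral>x. f c x \<partial>\<alpha> (snd c) \<omega>) \<partial>M)"
    proof (rule insert.IH)
      show "(\<lambda>\<omega>. B n \<omega> * I n \<omega>) \<in> borel_measurable (G n)" for n
        by (intro borel_measurable_times insert.prems IG)
      show "0 \<le> B n \<omega> * I n \<omega>" "B n \<omega> * I n \<omega> \<le> 1" for n \<omega>
        using insert.prems(2,3) I01 by (auto intro: mult_le_one)
      show "(\<lambda>\<omega>. b \<omega> * a \<omega>) \<in> borel_measurable M"
        by (intro borel_measurable_times insert.prems am)
      show "AE \<omega> in M. (\<lambda>n. B n \<omega> * I n \<omega>) \<longlonglongrightarrow> b \<omega> * a \<omega>"
        using insert.prems(5) Ia by eventually_elim (rule tendsto_mult)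
    qed
    from tendsto_add[OF this err] show ?thesis
      unfolding step using False insert.hyps(1) c by (simp add: a_def ac_simps)
  qed
qed

lemma measurable_shifted_array: "(\<lambda>\<omega> m i. X (n + 1 + m) i \<omega>) \<in> borel_measurable M"
  by (intro measurable_coordinatewise_then_product measurable_X) simp

lemma weak_conv_shifted_array:
  "weak_conv_top (\<lambda>n. distr M borel (\<lambda>\<omega> m i. X (n + 1 + m) i \<omega>)) (mixture_law M \<alpha>)"
proof -
  interpret cd: convergence_determining "cylinder_functions :: ((nat \<Rightarrow> 'i \<Rightarrow> 'x) \<Rightarrow> real) set"
    by (rule convergence_determining_cylinder_functions)
  show ?thesis
  proof (rule cd.weak_conv_topI)
    show "prob_space (distr M borel (\<lambda>\<omega> m i. X (n + 1 + m) i \<omega>))" for n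
      by (rule prob_space_distr[OF measurable_shifted_array])
    fix g :: "(nat \<Rightarrow> 'i \<Rightarrow> 'x) \<Rightarrow> real" assume "g \<in> cylinder_functions"
    then obtain C f where g: "g = cylinder_prod C f" "finite C" "\<And>c. unit_continuous (f c)"
      unfolding cylinder_functions_def by blast
    \<comment> \<open>The factor 1 is the initial weight \<open>B n\<close> of the cell-removal
      lemma.\<close>
    have "(\<integral>z. g z \<partial>distr M borel (\<lambda>\<omega> m i. X (n + 1 + m) i \<omega>)) =
        (\<integral>\<omega>. 1 * (\<Prod>c\<in>C. f c (X (Suc (n + fst c)) (snd c) \<omega>)) \<partial>M)" for n
      unfolding g(1) by (subst integral_distr[OF measurable_shifted_array cylinder_prod_measurable[OF g(3)]])
        (simp add: cylinder_prod_def)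
    moreover have "(\<lambda>n. \<integral>\<omega>. 1 * (\<Prod>c\<in>C. f c (X (Suc (n + fst c)) (snd c) \<omega>)) \<partial>M)
        \<longlonglongrightarrow> (\<integral>\<omega>. 1 * (\<Prod>c\<in>C. \<integral>x. f c x \<partial>\<alpha> (snd c) \<omega>) \<partial>M)"
      by (rule tendsto_integral_shifted_cells[OF g(2,3)]) auto
    ultimately show "(\<lambda>n. \<integral>z. g z \<partial>distr M borel (\<lambda>\<omega> m i. X (n + 1 + m) i \<omega>))
        \<longlonglongrightarrow> (\<integral>z. g z \<partial>mixture_law M \<alpha>)"
      unfolding g(1) by (simp add: integral_mixture_law_cylinder_prod[OF g(2,3)])
  qed (auto simp: sets_mixture_law prob_space_mixture_law)
qed

end

theorem mainTheorem8:
  fixes M :: "'w measure"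
    and G :: "nat \<Rightarrow> 'w measure"
    and X :: "nat \<Rightarrow> 'i::countable \<Rightarrow> 'w \<Rightarrow> 'x::polish_space"
    and \<alpha> :: "'i \<Rightarrow> 'w \<Rightarrow> 'x measure"
  assumes "prob_space M"
    and "filtration_on M G"
    and "partially_cid M G X"
    and "directing_measures M G X \<alpha>"
  shows "partially_exchangeable_law (mixture_law M \<alpha>)
       \<and> weak_conv_top (\<lambda>n. distr M borel (\<lambda>\<omega>. \<lambda>m i. X (n + 1 + m) i \<omega>)) (mixture_law M \<alpha>)"
proof -
  interpret prob_space M by fact
  interpret partially_cid_process M \<alpha> G X
    using assms by unfold_locales (auto simp: directing_measures_def)
  show ?thesis
    using partially_exchangeable_mixture_law weak_conv_shifted_array by blast
qed

end
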